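(* Let $H:\mathbb{R}\times\mathbb{R}^N\to[0,+\infty)$ be continuous. Assume that there exists a Borel locally bounded function $K:\mathbb{R}\to[0,+\infty)$ such that, for every $t\in\mathbb{R}$, there exists $\zeta_t\in\mathbb{R}^N$ satisfying $$H(t,\xi)\geq K(t)+\langle\zeta_t,\xi\rangle\qquad\text{for every }\xi\in\mathbb{R}^N.$$ Then, for every $u\in\mathcal A$, one has $K\circ u\in L^1(\Omega)$.
   Context: Let $N\ge 1$, let $\Omega\subset\mathbb{R}^N$ be a bounded open set, $1\leq p\leq N$, and $\varphi\in W^{1,p}(\mathbb{R}^N)\cap L^\infty(\mathbb{R}^N)$. $W^{1,p}_0(\Omega)$ is the closure in $W^{1,p}(\Omega)$ of the $C^1$ functions with compact support in $\Omega$, and $W^{1,p}_\varphi(\Omega)=\varphi+W^{1,p}_0(\Omega)$. Here $\mathcal A=\{u\in W^{1,p}_\varphi(\Omega): H(u,\nabla u)\in L^1(\Omega)\}$. *)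

theory Defs
  imports "HOL-Analysis.Analysis"
begin

text \<open>
  Elements of the function spaces over an open set \<open>\<Omega>\<close> are represented by total functions
  on the ambient space; values outside \<open>\<Omega>\<close> are irrelevant, and functions agreeing almost
  everywhere on \<open>\<Omega>\<close> are not identified.
\<close>

definition locally_bounded :: "('a::topological_space \<Rightarrow> 'b::metric_space) \<Rightarrow> bool" where
  "locally_bounded f \<longleftrightarrow> (\<forall>t. \<exists>U. open U \<and> t \<in> U \<and> bounded (f ` U))"

definition Lp_space :: "'a::euclidean_space set \<Rightarrow> real \<Rightarrow> ('a \<Rightarrow> 'b::euclidean_space) set" where
  "Lp_space \<Omega> p = {f \<in> borel_measurable (lebesgue_on \<Omega>).
     integrable (lebesgue_on \<Omega>) (\<lambda>x. norm (f x) powr p)}"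

definition Linf_space :: "'a::euclidean_space set \<Rightarrow> ('a \<Rightarrow> 'b::euclidean_space) set" where
  "Linf_space \<Omega> = {f \<in> borel_measurable (lebesgue_on \<Omega>).
     \<exists>M. AE x in lebesgue_on \<Omega>. norm (f x) \<le> M}"

definition L1_loc :: "'a::euclidean_space set \<Rightarrow> ('a \<Rightarrow> 'b::euclidean_space) set" where
  "L1_loc \<Omega> = {f. \<forall>C. compact C \<and> C \<subseteq> \<Omega> \<longrightarrow> integrable (lebesgue_on C) f}"

text \<open>
  A function with compact support in \<open>\<Omega>\<close> is taken to be zero outside \<open>\<Omega>\<close>, so being
  \<open>C\<^sup>1\<close> on \<open>\<Omega>\<close> and on the whole space amount to the same.
\<close>

definition C1c :: "'a::euclidean_space set \<Rightarrow> ('a \<Rightarrow> real) set" where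
  "C1c \<Omega> = {\<psi>. (\<forall>x. \<psi> differentiable (at x)) \<and>
     (\<forall>i\<in>Basis. continuous_on UNIV (\<lambda>x. frechet_derivative \<psi> (at x) i)) \<and>
     compact (closure {x. \<psi> x \<noteq> 0}) \<and> closure {x. \<psi> x \<noteq> 0} \<subseteq> \<Omega>}"

definition has_weak_gradient ::
    "'a::euclidean_space set \<Rightarrow> ('a \<Rightarrow> real) \<Rightarrow> ('a \<Rightarrow> 'a) \<Rightarrow> bool" where
  "has_weak_gradient \<Omega> u g \<longleftrightarrow> u \<in> L1_loc \<Omega> \<and> g \<in> L1_loc \<Omega> \<and>
     (\<forall>\<psi>\<in>C1c \<Omega>. \<forall>i\<in>Basis.
        (LINT x|lebesgue_on \<Omega>. u x * frechet_derivative \<psi> (at x) i)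
          = - (LINT x|lebesgue_on \<Omega>. (g x \<bullet> i) * \<psi> x))"

text \<open>
  The weak gradient is determined only almost everywhere on \<open>\<Omega>\<close>; an arbitrary
  representative is chosen. It is meaningful only if some weak gradient exists.
\<close>

definition weak_gradient ::
    "'a::euclidean_space set \<Rightarrow> ('a \<Rightarrow> real) \<Rightarrow> ('a \<Rightarrow> 'a)" where
  "weak_gradient \<Omega> u = (SOME g. has_weak_gradient \<Omega> u g)"

definition W1p :: "'a::euclidean_space set \<Rightarrow> real \<Rightarrow> ('a \<Rightarrow> real) set" where
  "W1p \<Omega> p = {u \<in> Lp_space \<Omega> p. \<exists>g\<in>Lp_space \<Omega> p. has_weak_gradient \<Omega> u g}"

definition W1p_norm :: "'a::euclidean_space set \<Rightarrow> real \<Rightarrow> ('a \<Rightarrow> real) \<Rightarrow> real" where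
  "W1p_norm \<Omega> p u =
     ((LINT x|lebesgue_on \<Omega>. \<bar>u x\<bar> powr p)
      + (LINT x|lebesgue_on \<Omega>. norm (weak_gradient \<Omega> u x) powr p)) powr (1 / p)"

definition W1p_0 :: "'a::euclidean_space set \<Rightarrow> real \<Rightarrow> ('a \<Rightarrow> real) set" where
  "W1p_0 \<Omega> p = {u \<in> W1p \<Omega> p.
     \<forall>\<epsilon>>0. \<exists>\<psi>\<in>C1c \<Omega>. W1p_norm \<Omega> p (\<lambda>x. u x - \<psi> x) < \<epsilon>}"

definition W1p_bdry ::
    "'a::euclidean_space set \<Rightarrow> real \<Rightarrow> ('a \<Rightarrow> real) \<Rightarrow> ('a \<Rightarrow> real) set" where
  "W1p_bdry \<Omega> p \<phi> = {\<lambda>x. \<phi> x + v x | v. v \<in> W1p_0 \<Omega> p}"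

definition admissible ::
    "'a::euclidean_space set \<Rightarrow> real \<Rightarrow> ('a \<Rightarrow> real) \<Rightarrow> (real \<times> 'a \<Rightarrow> real)
      \<Rightarrow> ('a \<Rightarrow> real) set" where
  "admissible \<Omega> p \<phi> H = {u \<in> W1p_bdry \<Omega> p \<phi>.
     integrable (lebesgue_on \<Omega>) (\<lambda>x. H (u x, weak_gradient \<Omega> u x))}"

end

theory Submission
  imports Defs
begin

text \<open>
  Fix \<open>M\<close> with \<open>\<bar>\<phi>\<bar> \<le> M\<close> almost everywhere. Where \<open>\<bar>u\<bar> \<le> M\<close>, the function \<open>K \<circ> u\<close> is bounded.
  Elsewhere \<open>K (u) \<le> H (u, \<nabla>u) - \<zeta>\<^sub>u \<bullet> \<nabla>u\<close>, and the last term should integrate to zero, because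
  \<open>\<integral> \<nabla>u = 0\<close> over \<open>{x \<in> \<Omega>. u x \<in> A}\<close> for every Borel set \<open>A\<close> disjoint from \<open>{-M..M}\<close>.
  To avoid a measurable selection of \<open>\<zeta>\<^sub>t\<close>, replace \<open>H (t, \<xi>)\<close> by \<open>H (t, \<xi>) + norm \<xi>\<close>, which is harmless
  since \<open>\<nabla>u\<close> is integrable: then countably many slopes suffice, each on a Borel set of values \<open>t\<close>.

  For the vanishing integral, multiply \<open>\<phi>\<close> by a cutoff which is \<open>1\<close> on \<open>\<Omega>\<close> and add the extension by
  zero of \<open>u - \<phi>\<close>. This gives \<open>U\<close> in \<open>W\<^sup>1\<^sup>,\<^sup>1\<close> of the whole space with \<open>\<bar>U\<bar> \<le> M\<close> outside \<open>\<Omega>\<close>. Its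
  difference quotients converge to \<open>\<nabla>U\<close> in \<open>L\<^sup>1\<close>, so for a \<open>C\<^sup>1\<close> function \<open>\<eta>\<close> with \<open>k = \<eta>'\<close> bounded and
  Lipschitz, translation invariance of \<open>\<integral> \<eta> (U)\<close> gives \<open>\<integral> k (U) \<nabla>U = 0\<close>; indicators of intervals are
  limits of such \<open>k\<close>.
\<close>

subsection \<open>Continuously differentiable functions with compact support\<close>

text \<open>Arbitrary Borel sets \<open>A\<close> are needed because the sets of values on which one
  slope works are only known to be Borel; they are reached from intervals by a Dynkin argument.
  Disjointness from \<open>{-M..M}\<close> makes the boundary values drop out: outside \<Omega> the
  gradient of the auxiliary function contains the derivative of the cutoff and need not vanish, but
  there the function never takes a value in \<open>A\<close>.

  The slopes need not be bounded over the countably many pieces, so the piecewise product of slope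
  and gradient need not be integrable over all of \<Omega>, and its integral cannot be cancelled in
  one stroke. The cancellation is therefore done on each piece, where the slope is constant, and
  only the resulting inequalities between nonnegative integrals are summed.

  The exponent \<open>p\<close> is removed early: \<Omega> has finite measure, so approximation in
  the Sobolev norm implies approximation of the function and of its gradient in L^1, and the
  analysis on the whole space takes place in L^1.\<close>

definition C1_gradient :: "('a::euclidean_space \<Rightarrow> real) \<Rightarrow> ('a \<Rightarrow> 'a) \<Rightarrow> bool" where
  "C1_gradient f D \<longleftrightarrow>
     (\<forall>x. (f has_derivative (\<lambda>h. D x \<bullet> h)) (at x)) \<and> continuous_on UNIV D"

lemma C1_gradient_continuous: "C1_gradient f D \<Longrightarrow> continuous_on A f"
  unfolding C1_gradient_def
  by (meson continuous_at_imp_continuous_on has_derivative_continuous)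

lemma C1_gradient_const: "C1_gradient (\<lambda>x. c) (\<lambda>x. 0)"
  by (simp add: C1_gradient_def)

lemma C1_gradient_inner: "C1_gradient (\<lambda>x. x \<bullet> b) (\<lambda>x. b)"
  by (auto simp: C1_gradient_def inner_commute intro!: derivative_eq_intros)

lemma C1_gradient_inner_self: "C1_gradient (\<lambda>x. x \<bullet> x) (\<lambda>x. 2 *\<^sub>R x)"
  by (auto simp: C1_gradient_def inner_commute intro!: derivative_eq_intros continuous_intros)

lemma C1_gradient_diff:
  "C1_gradient f D \<Longrightarrow> C1_gradient g E \<Longrightarrow> C1_gradient (\<lambda>x. f x - g x) (\<lambda>x. D x - E x)"
  by (auto simp: C1_gradient_def inner_diff_left intro!: derivative_eq_intros continuous_intros)

lemma C1_gradient_mult: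
  assumes "C1_gradient f D" "C1_gradient g E"
  shows "C1_gradient (\<lambda>x. f x * g x) (\<lambda>x. f x *\<^sub>R E x + g x *\<^sub>R D x)"
proof -
  have "continuous_on UNIV f" "continuous_on UNIV g"
    using assms C1_gradient_continuous by blast+
  with assms show ?thesis
    by (auto simp: C1_gradient_def inner_add_left intro!: derivative_eq_intros continuous_intros)
qed

lemma C1_gradient_compose:
  fixes f :: "'a::euclidean_space \<Rightarrow> real" and r :: "real \<Rightarrow> real"
  assumes f: "C1_gradient f D"
    and r: "\<And>t. (r has_real_derivative r' t) (at t)" "continuous_on UNIV r'"
  shows "C1_gradient (\<lambda>x. r (f x)) (\<lambda>x. r' (f x) *\<^sub>R D x)"
proof -
  have "continuous_on UNIV (\<lambda>x. r' (f x))"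
    by (rule continuous_on_compose2[OF r(2) C1_gradient_continuous[OF f]]) auto
  moreover have "((\<lambda>x. r (f x)) has_derivative (\<lambda>h. (r' (f x) *\<^sub>R D x) \<bullet> h)) (at x)" for x
    using has_derivative_compose[of f "\<lambda>h. D x \<bullet> h" x UNIV r "\<lambda>h. r' (f x) * h"] f r(1)[of "f x"]
    by (simp add: C1_gradient_def has_field_derivative_def)
  ultimately show ?thesis
    using f by (auto simp: C1_gradient_def intro!: continuous_intros)
qed

lemma C1_gradient_prod:
  fixes f :: "'i \<Rightarrow> 'a::euclidean_space \<Rightarrow> real"
  assumes "finite I" "\<And>i. i \<in> I \<Longrightarrow> \<exists>D. C1_gradient (f i) D"
  shows "\<exists>D. C1_gradient (\<lambda>x. \<Prod>i\<in>I. f i x) D"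
  using assms
proof (induction I rule: finite_induct)
  case empty
  then show ?case using C1_gradient_const[of 1] by auto
next
  case (insert i I)
  then obtain D where "C1_gradient (f i) D" by blast
  moreover obtain E where "C1_gradient (\<lambda>x. \<Prod>i\<in>I. f i x) E" using insert by auto
  ultimately show ?case
    using C1_gradient_mult[of "f i" D "\<lambda>x. \<Prod>i\<in>I. f i x" E] insert.hyps by auto
qed

lemma C1_gradient_translate:
  assumes "C1_gradient f D" shows "C1_gradient (\<lambda>x. f (x + c)) (\<lambda>x. D (x + c))"
proof -
  have "((\<lambda>x. f (x + c)) has_derivative (\<lambda>h. D (x + c) \<bullet> h)) (at x)" for x
  proof -
    have "((\<lambda>x. x + c) has_derivative (\<lambda>h. h)) (at x)" by (auto intro!: derivative_eq_intros)
    then show ?thesis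
      using has_derivative_compose[of "\<lambda>x. x + c" "\<lambda>h. h" x UNIV f "\<lambda>h. D (x + c) \<bullet> h"] assms
      by (auto simp: C1_gradient_def)
  qed
  moreover have "continuous_on UNIV (\<lambda>x. D (x + c))"
    using assms by (auto simp: C1_gradient_def intro!: continuous_intros continuous_on_compose2[of UNIV D])
  ultimately show ?thesis by (simp add: C1_gradient_def)
qed

lemma C1_gradient_frechet:
  "C1_gradient f D \<Longrightarrow> frechet_derivative f (at x) = (\<lambda>h. D x \<bullet> h)"
  by (simp add: C1_gradient_def frechet_derivative_at[symmetric])

text \<open>Near such a point \<open>f\<close> vanishes identically. So the gradient of a test
  function lives on the same compact set as the function, which yields its boundedness and
  integrability.\<close>

lemma C1_gradient_zero_outside:
  assumes "C1_gradient f D" "x \<notin> closure {x. f x \<noteq> 0}" shows "D x = 0"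
proof -
  define S where "S = - closure {x. f x \<noteq> 0}"
  have zero: "0 = f y" if "y \<in> S" for y
    using that closure_subset[of "{x. f x \<noteq> 0}"] by (auto simp: S_def)
  have "open S" "x \<in> S" using assms(2) by (auto simp: S_def)
  then have "(f has_derivative (\<lambda>h. 0)) (at x)"
    by (rule has_derivative_transform_within_open[where f="\<lambda>y. 0", OF has_derivative_const _ _ zero])
  with assms(1) have "(\<lambda>h. D x \<bullet> h) = (\<lambda>h. 0)"
    unfolding C1_gradient_def using has_derivative_unique by blast
  then show "D x = 0" by (metis inner_eq_zero_iff)
qed

text \<open>A linear map is determined by its values on the basis, so the continuous partial
  derivatives assemble into a continuous gradient field. Working with the field makes the product
  and chain rules explicit.\<close>

lemma C1c_iff:
  "\<psi> \<in> C1c \<Omega> \<longleftrightarrow> (\<exists>D. C1_gradient \<psi> D) \<and>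
     compact (closure {x. \<psi> x \<noteq> 0}) \<and> closure {x. \<psi> x \<noteq> 0} \<subseteq> \<Omega>"
proof (safe)
  assume \<psi>: "\<psi> \<in> C1c \<Omega>"
  let ?D = "\<lambda>x. \<Sum>i\<in>Basis. frechet_derivative \<psi> (at x) i *\<^sub>R i"
  have *: "frechet_derivative \<psi> (at x) = (\<lambda>h. ?D x \<bullet> h)" for x
  proof
    fix h
    have "linear (frechet_derivative \<psi> (at x))"
      using \<psi> by (auto simp: C1c_def intro!: linear_frechet_derivative)
    then have "frechet_derivative \<psi> (at x) (\<Sum>i\<in>Basis. (h \<bullet> i) *\<^sub>R i) = 
        (\<Sum>i\<in>Basis. (h \<bullet> i) * frechet_derivative \<psi> (at x) i)"
      by (simp add: linear_sum linear_scale)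
    then show "frechet_derivative \<psi> (at x) h = ?D x \<bullet> h"
      by (simp add: euclidean_representation inner_sum_right inner_commute[of _ h] mult.commute)
  qed
  have "C1_gradient \<psi> ?D"
    unfolding C1_gradient_def *[symmetric]
    using \<psi> by (auto simp: C1c_def frechet_derivative_works[symmetric] intro!: continuous_intros)
  then show "\<exists>D. C1_gradient \<psi> D" by blast
next
  fix D assume D: "C1_gradient \<psi> D" "compact (closure {x. \<psi> x \<noteq> 0})" "closure {x. \<psi> x \<noteq> 0} \<subseteq> \<Omega>"
  have "\<psi> differentiable (at x)" for x
    using D(1) unfolding C1_gradient_def differentiable_def by blast
  moreover have "continuous_on UNIV (\<lambda>x. D x \<bullet> i)" for i
    using D(1) by (auto simp: C1_gradient_def intro!: continuous_intros)
  ultimately show "\<psi> \<in> C1c \<Omega>"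
    using D by (auto simp: C1c_def C1_gradient_frechet)
qed (auto simp: C1c_def)

lemma C1c_continuous: "\<psi> \<in> C1c \<Omega> \<Longrightarrow> continuous_on A \<psi>"
  using C1_gradient_continuous by (auto simp: C1c_iff)

lemma C1c_boundedE:
  assumes "\<psi> \<in> C1c \<Omega>" "C1_gradient \<psi> D"
  obtains B where "0 \<le> B" "\<And>x. \<bar>\<psi> x\<bar> \<le> B" "\<And>x. norm (D x) \<le> B"
proof -
  let ?C = "closure {x. \<psi> x \<noteq> 0}"
  have C: "compact ?C" using assms by (simp add: C1c_iff)
  have "bounded (\<psi> ` ?C)" "bounded (D ` ?C)"
    using C assms(2) C1_gradient_continuous[OF assms(2)]
    by (auto intro!: compact_imp_bounded compact_continuous_image simp: C1_gradient_def
        intro: continuous_on_subset)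
  then obtain B1 B2 where B: "\<And>x. x \<in> ?C \<Longrightarrow> \<bar>\<psi> x\<bar> \<le> B1" "\<And>x. x \<in> ?C \<Longrightarrow> norm (D x) \<le> B2"
    unfolding bounded_iff by auto
  show ?thesis
  proof
    show "\<bar>\<psi> x\<bar> \<le> max 0 (max B1 B2)" for x
      using B(1)[of x] closure_subset[of "{x. \<psi> x \<noteq> 0}"] by (cases "\<psi> x = 0") auto
    show "norm (D x) \<le> max 0 (max B1 B2)" for x
      using B(2)[of x] C1_gradient_zero_outside[OF assms(2), of x] by (cases "x \<in> ?C") auto
  qed auto
qed

lemma C1c_subset: "\<Omega> \<subseteq> \<Omega>' \<Longrightarrow> C1c \<Omega> \<subseteq> C1c \<Omega>'"
  by (auto simp: C1c_def)

lemma C1c_mult: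
  assumes "C1_gradient f D" "\<psi> \<in> C1c \<Omega>"
  shows "(\<lambda>x. f x * \<psi> x) \<in> C1c \<Omega>"
proof -
  have *: "closure {x. f x * \<psi> x \<noteq> 0} \<subseteq> closure {x. \<psi> x \<noteq> 0}" by (intro closure_mono) auto
  moreover have "compact (closure {x. f x * \<psi> x \<noteq> 0})"
    using assms(2) bounded_subset[of "{x. \<psi> x \<noteq> 0}" "{x. f x * \<psi> x \<noteq> 0}"] by (auto simp: C1c_iff)
  ultimately show ?thesis
    using assms C1_gradient_mult[OF assms(1)] unfolding C1c_iff by blast
qed

lemma C1c_translate:
  assumes "\<psi> \<in> C1c UNIV" shows "(\<lambda>x. \<psi> (x + c)) \<in> C1c UNIV"
proof -
  have "{x. \<psi> (x + c) \<noteq> 0} = (\<lambda>x. x - c) ` {x. \<psi> x \<noteq> 0}"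
    by (auto simp: image_iff algebra_simps intro!: exI[of _ "_ + c"])
  moreover have "bounded {x. \<psi> x \<noteq> 0}"
    using assms by (auto simp: C1c_iff)
  ultimately have "bounded {x. \<psi> (x + c) \<noteq> 0}"
    by (metis bounded_translation_minus)
  then show ?thesis using assms C1_gradient_translate by (fastforce simp: C1c_iff)
qed

text \<open>\<open>s * (s + \<bar>s\<bar>) / 2\<close> is the square of the positive part of \<open>s\<close>.\<close>

lemma pos_part_square_deriv:
  "((\<lambda>s::real. s * (s + \<bar>s\<bar>) / 2) has_real_derivative (s + \<bar>s\<bar>)) (at s)"
proof (cases "s = 0")
  case True
  have "((\<lambda>h. (h + \<bar>h\<bar>) / 2) \<longlongrightarrow> (0 + \<bar>0\<bar>) / 2) (at (0::real))"
    by (intro tendsto_intros) auto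
  then have "((\<lambda>h. (h * (h + \<bar>h\<bar>) / 2) / h) \<longlongrightarrow> 0) (at (0::real))"
    by (rule filterlim_cong[THEN iffD1, rotated 3]) (auto simp: eventually_at_filter)
  then show ?thesis using True by (simp add: DERIV_def)
next
  case False
  then show ?thesis
  proof (cases "s > 0")
    case True
    have "((\<lambda>s::real. s * s) has_real_derivative (s + \<bar>s\<bar>)) (at s)"
      using True by (auto intro!: derivative_eq_intros)
    then show ?thesis
      by (rule has_field_derivative_transform_within_open[where S="{0<..}"]) (use True in auto)
  next
    case neg: False
    then have "((\<lambda>s::real. 0) has_real_derivative (s + \<bar>s\<bar>)) (at s)" by simp
    then show ?thesis
      by (rule has_field_derivative_transform_within_open[where S="{..<0}"]) (use False neg in auto)
  qed
qed

lemma C1_gradient_pos_part_square: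
  "C1_gradient f D \<Longrightarrow> \<exists>E. C1_gradient (\<lambda>x. f x * (f x + \<bar>f x\<bar>) / 2) E"
  using C1_gradient_compose[OF _ pos_part_square_deriv] by (force intro!: continuous_intros)

text \<open>Each factor is the squared positive part of the signed coordinate distance to one face.
  Squaring makes it continuously differentiable, and the product is nonzero exactly when all these
  distances are positive.\<close>

lemma C1_box_function:
  fixes a b :: "'a::euclidean_space"
  obtains P D where "C1_gradient P D" "\<And>x. 0 \<le> P x" "\<And>x. P x \<noteq> 0 \<longleftrightarrow> x \<in> box a b"
proof -
  define q :: "real \<Rightarrow> real" where "q s = s * (s + \<bar>s\<bar>) / 2" for s
  have q: "0 \<le> q s" "q s \<noteq> 0 \<longleftrightarrow> 0 < s" for s
    by (auto simp: q_def zero_le_mult_iff)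
  define P where "P x = (\<Prod>i\<in>Basis. q (x \<bullet> i - a \<bullet> i) * q (b \<bullet> i - x \<bullet> i))" for x
  have "\<exists>D. C1_gradient P D"
    unfolding P_def
  proof (rule C1_gradient_prod)
    fix i :: 'a
    have "C1_gradient (\<lambda>x. x \<bullet> i - a \<bullet> i) (\<lambda>x. i - 0)" "C1_gradient (\<lambda>x. b \<bullet> i - x \<bullet> i) (\<lambda>x. 0 - i)"
      by (intro C1_gradient_diff C1_gradient_inner C1_gradient_const)+
    from this[THEN C1_gradient_pos_part_square]
    show "\<exists>D. C1_gradient (\<lambda>x. q (x \<bullet> i - a \<bullet> i) * q (b \<bullet> i - x \<bullet> i)) D"
      unfolding q_def using C1_gradient_mult by blast
  qed simp
  moreover have "0 \<le> P x" "P x \<noteq> 0 \<longleftrightarrow> x \<in> box a b" for x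
    using q by (auto simp: P_def mem_box intro!: prod_nonneg)
  ultimately show ?thesis using that by blast
qed

text \<open>Compose multiples of the box function \<open>P\<close> with \<open>r\<close>, which
  vanishes at 0, stays in [0,1] and tends to 1 at infinity. Since \<open>P\<close> is nonzero
  exactly on the open box, the limit is the indicator of the open box; the supports fill the closed
  one, hence the hypothesis on \<open>cbox a b\<close>.\<close>

lemma C1c_approx_box:
  fixes a b :: "'a::euclidean_space"
  assumes "cbox a b \<subseteq> \<Omega>"
  obtains \<psi> where "\<And>n::nat. \<psi> n \<in> C1c \<Omega>" "\<And>n x. \<bar>\<psi> n x\<bar> \<le> indicator (cbox a b) x"
    "\<And>x. (\<lambda>n. \<psi> n x) \<longlonglongrightarrow> indicator (box a b) x"
proof -
  obtain P and D where P: "C1_gradient P D" "\<And>x. 0 \<le> P x" "\<And>x. P x \<noteq> 0 \<longleftrightarrow> x \<in> box a b"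
    by (rule C1_box_function[of a b]) blast
  define r :: "real \<Rightarrow> real" where "r t = t\<^sup>2 / (1 + t\<^sup>2)" for t
  have nz: "1 + t\<^sup>2 \<noteq> 0" for t :: real by (smt (verit) zero_le_power2)
  have r: "(r has_real_derivative 2 * t / (1 + t\<^sup>2)\<^sup>2) (at t)" for t
    unfolding r_def using nz[of t]
    by (auto intro!: derivative_eq_intros simp: field_simps power2_eq_square)
  have rc: "continuous_on UNIV (\<lambda>t::real. 2 * t / (1 + t\<^sup>2)\<^sup>2)"
    using nz by (auto intro!: continuous_intros)
  have r01: "0 \<le> r t" "r t \<le> 1" for t
    by (auto simp: r_def divide_simps) (smt (verit) zero_le_power2)+
  define \<psi> where "\<psi> n x = r (real n * P x)" for n x
  show ?thesis
  proof
    fix n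
    have eq: "{x. \<psi> n x \<noteq> 0} \<subseteq> box a b"
      using P(3) by (auto simp: \<psi>_def r_def)
    then have *: "closure {x. \<psi> n x \<noteq> 0} \<subseteq> cbox a b"
      by (meson box_subset_cbox closed_cbox closure_minimal order_trans)
    then have "compact (closure {x. \<psi> n x \<noteq> 0})"
      by (meson bounded_cbox bounded_subset closed_closure compact_eq_bounded_closed)
    moreover have "\<exists>D. C1_gradient (\<psi> n) D"
      unfolding \<psi>_def using C1_gradient_compose[OF C1_gradient_mult[OF C1_gradient_const P(1)] r rc] by blast
    ultimately show "\<psi> n \<in> C1c \<Omega>" using * assms by (auto simp: C1c_iff)
    show "\<bar>\<psi> n x\<bar> \<le> indicator (cbox a b) x" for x
      using eq r01[of "real n * P x"] box_subset_cbox[of a b] by (cases "x \<in> cbox a b") (fastforce simp: \<psi>_def)+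
  next
    fix x
    show "(\<lambda>n. \<psi> n x) \<longlonglongrightarrow> indicator (box a b) x"
    proof (cases "x \<in> box a b")
      case True
      with P have p: "P x > 0" by (metis less_eq_real_def)
      have "((\<lambda>t. r t) \<longlongrightarrow> 1) at_top"
      proof -
        have "((\<lambda>t::real. 1 - inverse (1 + t\<^sup>2)) \<longlongrightarrow> 1 - 0) at_top"
          by (intro tendsto_intros tendsto_inverse_0_at_top filterlim_tendsto_add_at_top[OF tendsto_const]
             filterlim_pow_at_top filterlim_ident) auto
        moreover have "1 - inverse (1 + t\<^sup>2) = r t" for t
          using nz[of t] by (simp add: r_def field_simps)
        ultimately show ?thesis by simp
      qed
      moreover have "filterlim (\<lambda>n. real n * P x) at_top sequentially"
        using p by (intro filterlim_at_top_mult_tendsto_pos[OF tendsto_const] filterlim_real_sequentially)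
      ultimately show ?thesis using True filterlim_compose by (auto simp: \<psi>_def)
    next
      case False
      then show ?thesis using P(3)[of x] by (simp add: \<psi>_def r_def)
    qed
  qed
qed

lemma C1c_cutoff:
  fixes S :: "'a::euclidean_space set"
  assumes "bounded S"
  obtains \<theta> where "\<theta> \<in> C1c UNIV" "\<And>x. x \<in> S \<Longrightarrow> \<theta> x = 1" "\<And>x. 0 \<le> \<theta> x" "\<And>x. \<theta> x \<le> 1"
proof -
  obtain R where R: "\<And>x. x \<in> S \<Longrightarrow> norm x \<le> R" "0 < R"
    using assms by (auto simp: bounded_pos)
  define q :: "real \<Rightarrow> real" where "q s = s * (s + \<bar>s\<bar>) / 2" for s
  \<comment> \<open>For \<open>norm x \<le> R\<close> the inner \<open>q\<close> vanishes and
    \<open>q 1 = 1\<close> remains. For \<open>norm x > R + 1\<close> the inner argument is at least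
    1, so the outer argument is at most 0.\<close>
  define \<theta> :: "'a \<Rightarrow> real" where "\<theta> x = q (1 - q (x \<bullet> x - R\<^sup>2))" for x
  have q: "0 \<le> q s" "s \<le> 0 \<Longrightarrow> q s = 0" "s \<ge> 0 \<Longrightarrow> q s = s\<^sup>2" for s
    by (auto simp: q_def zero_le_mult_iff power2_eq_square)
  obtain E where E: "C1_gradient (\<lambda>x::'a. q (x \<bullet> x - R\<^sup>2)) E"
    using C1_gradient_pos_part_square[OF C1_gradient_diff[OF C1_gradient_inner_self C1_gradient_const]]
    unfolding q_def by blast
  have C1: "\<exists>D. C1_gradient \<theta> D"
    using C1_gradient_pos_part_square[OF C1_gradient_diff[OF C1_gradient_const E]]
    unfolding q_def \<theta>_def by blast
  have "\<theta> x = 0" if "norm x > R + 1" for x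
  proof -
    have "(norm x)\<^sup>2 \<ge> (R + 1)\<^sup>2" using that R by (intro power_mono) auto
    then have "x \<bullet> x - R\<^sup>2 \<ge> 1" using R by (simp add: power2_norm_eq_inner power2_sum)
    moreover from this have "q (x \<bullet> x - R\<^sup>2) \<ge> 1" using q(3) by simp
    ultimately show ?thesis using q(2) by (simp add: \<theta>_def)
  qed
  then have "{x. \<theta> x \<noteq> 0} \<subseteq> cball 0 (R + 1)" by (metis (mono_tags, lifting) linorder_not_le mem_Collect_eq mem_cball_0 subsetI)
  then have "bounded {x. \<theta> x \<noteq> 0}" using bounded_cball bounded_subset by blast
  then have "\<theta> \<in> C1c UNIV" using C1 by (auto simp: C1c_iff)
  moreover have "\<theta> x = 1" if "x \<in> S" for x
  proof -
    have "x \<bullet> x \<le> R\<^sup>2"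
      using R(1)[OF that] power_mono[of "norm x" R 2] by (simp add: power2_norm_eq_inner)
    then show ?thesis using q by (simp add: \<theta>_def)
  qed
  moreover have "0 \<le> \<theta> x" "\<theta> x \<le> 1" for x
  proof -
    show "0 \<le> \<theta> x" by (simp add: \<theta>_def q)
    have "q t \<le> 1" if "t \<le> 1" for t
      using q that by (cases "t \<ge> 0") (auto simp: power_le_one)
    then show "\<theta> x \<le> 1" using q(1) by (simp add: \<theta>_def)
  qed
  ultimately show ?thesis using that by blast
qed

subsection \<open>Translations in \<open>L\<^sup>1\<close>\<close>

text \<open>Boxes form an intersection-stable generator of the Borel sets, and the sets
  \<open>A\<close> with vanishing integral form a Dynkin system. With \<open>X\<close> the identity
  this serves the fundamental lemma of the calculus of variations, with \<open>X\<close> a Sobolev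
  function it serves its level sets.\<close>

lemma integral_vimage_borel_eq_0:
  fixes f :: "'a \<Rightarrow> real" and X :: "'a \<Rightarrow> 'b::euclidean_space"
  assumes f: "integrable M f" and X: "X \<in> borel_measurable M"
    and box: "\<And>a b. (LINT x|M. indicator (box a b) (X x) * f x) = 0"
    and A: "A \<in> sets borel"
  shows "(LINT x|M. indicator A (X x) * f x) = 0"
proof -
  let ?G = "range (\<lambda>(a, b). box a b :: 'b set)"
  have [measurable]: "f \<in> borel_measurable M" "X \<in> borel_measurable M" using f X by auto
  have int: "integrable M (\<lambda>x. indicator B (X x) * f x)" if [measurable]: "B \<in> sets borel" for B
    by (rule Bochner_Integration.integrable_bound[OF f]) (auto simp: indicator_def)
  \<comment> \<open>Closure under complements needs the whole space, which is exhausted by growing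
    boxes.\<close>
  have UNIV: "(LINT x|M. f x) = 0"
  proof -
    have "(\<lambda>n. LINT x|M. indicator (box (- (real n *\<^sub>R One)) (real n *\<^sub>R One)) (X x) * f x) \<longlonglongrightarrow> (LINT x|M. f x)"
    proof (rule integral_dominated_convergence[where w="\<lambda>x. \<bar>f x\<bar>"])
      show "AE x in M. (\<lambda>n. indicator (box (- (real n *\<^sub>R One)) (real n *\<^sub>R One)) (X x) * f x) \<longlonglongrightarrow> f x"
      proof (rule AE_I2)
        fix x
        obtain N :: nat where N: "norm (X x) < real N" using reals_Archimedean2 by blast
        have "X x \<in> box (- (real n *\<^sub>R One)) (real n *\<^sub>R One)" if "n \<ge> N" for n
        proof -
          have "\<bar>X x \<bullet> i\<bar> < real n" if "i \<in> Basis" for i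
            using Basis_le_norm[OF that, of "X x"] N \<open>n \<ge> N\<close> by simp
          then show ?thesis by (force simp: mem_box abs_less_iff)
        qed
        then show "(\<lambda>n. indicator (box (- (real n *\<^sub>R One)) (real n *\<^sub>R One)) (X x) * f x) \<longlonglongrightarrow> f x"
          by (intro tendsto_eventually eventually_sequentiallyI[of N]) simp
      qed
    qed (use f in \<open>auto simp: indicator_def\<close>)
    then show ?thesis by (simp add: box LIMSEQ_const_iff)
  qed
  have borel: "sigma_sets UNIV ?G = sets borel"
    by (subst borel_eq_box) (simp add: sets_measure_of)
  have "Int_stable ?G" by (auto simp: Int_stable_def Int_interval image_iff box_Int_box)
  moreover have "?G \<subseteq> Pow UNIV" "A \<in> sigma_sets UNIV ?G" using A borel by auto
  ultimately show ?thesis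
  proof (induction rule: sigma_sets_induct_disjoint)
    case (compl B)
    then have B[measurable]: "B \<in> sets borel" using borel by simp
    have "(LINT x|M. indicator (UNIV - B) (X x) * f x) = (LINT x|M. f x - indicator B (X x) * f x)"
      by (intro Bochner_Integration.integral_cong) (auto simp: indicator_def)
    then show ?case using compl UNIV int[OF B] f by simp
  next
    case (union B)
    then have B[measurable]: "B i \<in> sets borel" for i using borel by auto
    have "(\<lambda>n. LINT x|M. indicator (\<Union>i<n. B i) (X x) * f x) \<longlonglongrightarrow> (LINT x|M. indicator (\<Union>i. B i) (X x) * f x)"
    proof (rule integral_dominated_convergence[where w="\<lambda>x. \<bar>f x\<bar>"])
      show "AE x in M. (\<lambda>n. indicator (\<Union>i<n. B i) (X x) * f x) \<longlonglongrightarrow> indicator (\<Union>i. B i) (X x) * f x"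
        by (intro AE_I2 tendsto_mult tendsto_const LIMSEQ_indicator_UN)
    qed (use f in \<open>auto simp: indicator_def\<close>)
    moreover have "(LINT x|M. indicator (\<Union>i<n. B i) (X x) * f x) = 0" for n
    proof -
      have "disjoint_family_on B {..<n}" using union(1) by (auto simp: disjoint_family_on_def)
      then have "(LINT x|M. indicator (\<Union>i<n. B i) (X x) * f x) = (LINT x|M. (\<Sum>i<n. indicator (B i) (X x) * f x))"
        by (simp add: indicator_UN_disjoint sum_distrib_right)
      also have "\<dots> = 0" using union(3) int by (subst Bochner_Integration.integral_sum) auto
      finally show ?thesis .
    qed
    ultimately show ?case by (simp add: LIMSEQ_const_iff)
  qed (use box in auto)
qed

lemma integrable_lborel_translate:
  fixes f :: "'a::euclidean_space \<Rightarrow> 'b::{banach, second_countable_topology}"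
  assumes "integrable lborel f" shows "integrable lborel (\<lambda>x. f (x + c))"
proof -
  have "integrable (distr lborel borel ((+) c)) f" using assms by (simp add: lborel_distr_plus)
  then show ?thesis
    using assms by (subst (asm) integrable_distr_eq) (auto simp: add.commute)
qed

lemma integral_lborel_translate:
  fixes f :: "'a::euclidean_space \<Rightarrow> 'b::{banach, second_countable_topology}"
  assumes [measurable]: "f \<in> borel_measurable borel"
  shows "(LINT x|lborel. f (x + c)) = (LINT x|lborel. f x)"
proof -
  have "(LINT x|lborel. f x) = (LINT x|distr lborel borel ((+) c). f x)" by (simp add: lborel_distr_plus)
  also have "\<dots> = (LINT x|lborel. f (x + c))" by (subst integral_distr) (auto simp: add.commute)
  finally show ?thesis ..
qed

text \<open>Translations are isometries of L^1, so the approximation error enters twice, once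
  translated: two quarters of \<open>r\<close> for the errors and one half for
  \<open>g\<close>.\<close>

lemma L1_translation_limit_approx:
  fixes f :: "'a::euclidean_space \<Rightarrow> real"
  assumes f: "integrable lborel f"
    and approx: "\<And>e. e > 0 \<Longrightarrow> \<exists>g. integrable lborel g \<and> (LINT x|lborel. \<bar>f x - g x\<bar>) \<le> e \<and>
        (\<lambda>n. LINT x|lborel. \<bar>g (x + s n) - g x\<bar>) \<longlonglongrightarrow> 0"
  shows "(\<lambda>n. LINT x|lborel. \<bar>f (x + s n) - f x\<bar>) \<longlonglongrightarrow> 0"
proof (rule LIMSEQ_I)
  fix r :: real assume "r > 0"
  then obtain g where g: "integrable lborel g" "(LINT x|lborel. \<bar>f x - g x\<bar>) \<le> r/4"
      "(\<lambda>n. LINT x|lborel. \<bar>g (x + s n) - g x\<bar>) \<longlonglongrightarrow> 0" using approx[of "r/4"] by auto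
  have "(LINT x|lborel. \<bar>f (x + s n) - f x\<bar>) \<le> r/2 + (LINT x|lborel. \<bar>g (x + s n) - g x\<bar>)" for n
  proof -
    note [simp] = integrable_lborel_translate[OF f] integrable_lborel_translate[OF g(1)] f g(1)
    have "(LINT x|lborel. \<bar>f (x + s n) - f x\<bar>) \<le>
       (LINT x|lborel. \<bar>f (x + s n) - g (x + s n)\<bar> + \<bar>f x - g x\<bar> + \<bar>g (x + s n) - g x\<bar>)"
      by (intro integral_mono) auto
    also have "\<dots> = (LINT x|lborel. \<bar>f (x + s n) - g (x + s n)\<bar>) + (LINT x|lborel. \<bar>f x - g x\<bar>)
        + (LINT x|lborel. \<bar>g (x + s n) - g x\<bar>)" by simp
    also have "(LINT x|lborel. \<bar>f (x + s n) - g (x + s n)\<bar>) = (LINT x|lborel. \<bar>f x - g x\<bar>)"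
      using borel_measurable_integrable[OF f] borel_measurable_integrable[OF g(1)]
      by (intro integral_lborel_translate[of "\<lambda>x. \<bar>f x - g x\<bar>"]) simp
    finally show ?thesis using g(2) by simp
  qed
  moreover have "\<exists>no. \<forall>n\<ge>no. (LINT x|lborel. \<bar>g (x + s n) - g x\<bar>) < r/2"
    using order_tendstoD(2)[OF g(3), of "r/2"] \<open>r > 0\<close> by (simp add: eventually_sequentially)
  ultimately show "\<exists>no. \<forall>n\<ge>no. norm ((LINT x|lborel. \<bar>f (x + s n) - f x\<bar>) - 0) < r"
    by (simp, smt (verit) integral_nonneg_AE AE_I2 field_sum_of_halves)
qed

text \<open>For open \<open>U\<close> the positive part of \<open>\<lambda>x. indicator U x - indicator U (x + s n)\<close> tends to \<open>0\<close>
  pointwise, and its negative part has the same integral.\<close>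

lemma L1_translation_limit_open:
  fixes U :: "'a::euclidean_space set"
  assumes "open U" "emeasure lborel U < \<infinity>" "s \<longlonglongrightarrow> 0"
  shows "(\<lambda>n. LINT x|lborel. \<bar>indicator U (x + s n) - indicator U x :: real\<bar>) \<longlonglongrightarrow> 0"
proof -
  let ?I = "indicator U :: 'a \<Rightarrow> real"
  have [measurable]: "U \<in> sets borel" using assms by simp
  have int: "integrable lborel ?I" using assms by (simp add: integrable_indicator_iff)
  note [simp] = int integrable_lborel_translate[OF int]
  have "(\<lambda>n. LINT x|lborel. max 0 (?I x - ?I (x + s n))) \<longlonglongrightarrow> (LINT x::'a|lborel. 0)"
  proof (rule integral_dominated_convergence[where w="?I"])
    show "AE x in lborel. (\<lambda>n. max 0 (?I x - ?I (x + s n))) \<longlonglongrightarrow> 0"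
    proof (rule AE_I2)
      fix x :: 'a
      \<comment> \<open>Only this half of the difference converges everywhere: at a boundary point
        outside \<open>U\<close> the opposite one can equal 1 for all \<open>n\<close>.\<close>
      show "(\<lambda>n. max 0 (?I x - ?I (x + s n))) \<longlonglongrightarrow> 0"
      proof (cases "x \<in> U")
        case True
        have "(\<lambda>n. x + s n) \<longlonglongrightarrow> x + 0" by (intro tendsto_intros assms)
        then have "\<forall>\<^sub>F n in sequentially. x + s n \<in> U"
          using True assms(1) by (auto dest: topological_tendstoD)
        then show ?thesis by (intro tendsto_eventually) (auto elim!: eventually_mono simp: True)
      qed (auto simp: indicator_def)
    qed
  qed (auto simp: indicator_def)
  then have "(\<lambda>n. 2 * (LINT x|lborel. max 0 (?I x - ?I (x + s n)))) \<longlonglongrightarrow> 2 * 0"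
    by (intro tendsto_intros) simp
  moreover have "(LINT x|lborel. \<bar>?I (x + s n) - ?I x\<bar>) = 2 * (LINT x|lborel. max 0 (?I x - ?I (x + s n)))" for n
  proof -
    have "(LINT x|lborel. \<bar>?I (x + s n) - ?I x\<bar>) =
        (LINT x|lborel. 2 * max 0 (?I x - ?I (x + s n)) + (?I (x + s n) - ?I x))"
      by (intro Bochner_Integration.integral_cong) (auto simp: max_def)
    also have "\<dots> = 2 * (LINT x|lborel. max 0 (?I x - ?I (x + s n))) + ((LINT x|lborel. ?I (x + s n)) - (LINT x|lborel. ?I x))"
      by (subst Bochner_Integration.integral_add) auto
    also have "(LINT x|lborel. ?I (x + s n)) = (LINT x|lborel. ?I x)"
      by (rule integral_lborel_translate) simp
    finally show ?thesis by simp
  qed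
  ultimately show ?thesis by simp
qed

text \<open>The property passes to L^1 limits and sums, so indicators suffice, and by outer
  regularity indicators of open sets of finite measure.\<close>

lemma L1_translation_limit:
  fixes f :: "'a::euclidean_space \<Rightarrow> real"
  assumes "integrable lborel f" and s: "s \<longlonglongrightarrow> 0"
  shows "(\<lambda>n. LINT x|lborel. \<bar>f (x + s n) - f x\<bar>) \<longlonglongrightarrow> 0"
  using assms(1)
proof (induction rule: integrable_induct)
  case (base A c)
  then have A[measurable]: "A \<in> sets borel" by simp
  let ?I = "\<lambda>A x. indicator A x :: real"
  have intA: "integrable lborel (?I A)" using base by (simp add: integrable_indicator_iff)
  have "(\<lambda>n. LINT x|lborel. \<bar>?I A (x + s n) - ?I A x\<bar>) \<longlonglongrightarrow> 0"
  proof (rule L1_translation_limit_approx[OF intA])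
    fix e :: real assume "e > 0"
    then obtain U where U: "open U" "A \<subseteq> U" "emeasure lborel (U - A) < e"
      using outer_regular_lborel[OF A] by blast
    then have [measurable]: "U \<in> sets borel" by simp
    have "emeasure lborel U \<le> emeasure lborel A + emeasure lborel (U - A)"
      using emeasure_subadditive[of A lborel "U - A"] U(2) by (simp add: Un_absorb1)
    also have "\<dots> < \<infinity>" using base U(3) by (simp add: ennreal_add_less_top) (metis less_top ennreal_less_top order.strict_trans)
    finally have fin: "emeasure lborel U < \<infinity>" .
    have "(LINT x|lborel. \<bar>?I A x - ?I U x\<bar>) = (LINT x|lborel. ?I (U - A) x)"
      using U(2) by (intro Bochner_Integration.integral_cong) (auto simp: indicator_def)
    also have "\<dots> = measure lborel (U - A)" by simp
    also have "\<dots> \<le> e" using U(3) \<open>e > 0\<close> by (simp add: measure_def enn2real_leI less_imp_le)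
    finally show "\<exists>g. integrable lborel g \<and> (LINT x|lborel. \<bar>?I A x - g x\<bar>) \<le> e \<and>
        (\<lambda>n. LINT x|lborel. \<bar>g (x + s n) - g x\<bar>) \<longlonglongrightarrow> 0"
      using L1_translation_limit_open[OF U(1) fin s] fin by (intro exI[of _ "?I U"]) (simp add: integrable_indicator_iff)
  qed
  then have "(\<lambda>n. (LINT x|lborel. \<bar>?I A (x + s n) - ?I A x\<bar>) * \<bar>c\<bar>) \<longlonglongrightarrow> 0 * \<bar>c\<bar>"
    by (intro tendsto_intros)
  moreover have "\<bar>?I A (x + s n) *\<^sub>R c - ?I A x *\<^sub>R c\<bar> = \<bar>?I A (x + s n) - ?I A x\<bar> * \<bar>c\<bar>" for n x
    by (simp add: abs_mult[symmetric] left_diff_distrib)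
  ultimately show ?case by simp
next
  case (add f g)
  note [simp] = integrable_lborel_translate[OF add.hyps(1)] integrable_lborel_translate[OF add.hyps(2)] add.hyps
  show ?case
  proof (rule tendsto_sandwich[OF _ _ tendsto_const])
    show "(\<lambda>n. (LINT x|lborel. \<bar>f (x + s n) - f x\<bar>) + (LINT x|lborel. \<bar>g (x + s n) - g x\<bar>)) \<longlonglongrightarrow> 0"
      using tendsto_add[OF add.IH] by simp
    have "(LINT x|lborel. \<bar>f (x + s n) + g (x + s n) - (f x + g x)\<bar>) \<le>
        (LINT x|lborel. \<bar>f (x + s n) - f x\<bar> + \<bar>g (x + s n) - g x\<bar>)" for n
      by (intro integral_mono) auto
    then show "\<forall>\<^sub>F n in sequentially. (LINT x|lborel. \<bar>f (x + s n) + g (x + s n) - (f x + g x)\<bar>) \<le>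
        (LINT x|lborel. \<bar>f (x + s n) - f x\<bar>) + (LINT x|lborel. \<bar>g (x + s n) - g x\<bar>)" by simp
  qed simp
next
  case (lim f u)
  show ?case
  proof (rule L1_translation_limit_approx[OF lim.hyps(4)])
    fix e :: real assume "e > 0"
    have "(\<lambda>i. LINT x|lborel. \<bar>f x - u i x\<bar>) \<longlonglongrightarrow> (LINT x::'a|lborel. 0)"
    proof (rule integral_dominated_convergence[where w="\<lambda>x. 3 * \<bar>f x\<bar>"])
      show "AE x in lborel. (\<lambda>i. \<bar>f x - u i x\<bar>) \<longlonglongrightarrow> 0"
      proof (rule AE_I2)
        fix x :: 'a
        have "(\<lambda>i. \<bar>f x - u i x\<bar>) \<longlonglongrightarrow> \<bar>f x - f x\<bar>"
          by (intro tendsto_intros lim.hyps(2)) simp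
        then show "(\<lambda>i. \<bar>f x - u i x\<bar>) \<longlonglongrightarrow> 0" by simp
      qed
      \<comment> \<open>The approximants supplied by the induction rule satisfy
        \<open>\<bar>u i x\<bar> \<le> 2 * \<bar>f x\<bar>\<close>, whence the factor 3.\<close>
      show "AE x in lborel. norm \<bar>f x - u i x\<bar> \<le> 3 * \<bar>f x\<bar>" for i
        using lim.hyps(3)[of _ i] by (intro AE_I2) (auto intro: order_trans[OF abs_triangle_ineq4])
    qed (use lim.hyps(1,4) in auto)
    then obtain i where "(LINT x|lborel. \<bar>f x - u i x\<bar>) \<le> e"
      using \<open>e > 0\<close> order_tendstoD(2)[of _ 0 sequentially e]
      by (force simp: eventually_sequentially intro: less_imp_le)
    then show "\<exists>g. integrable lborel g \<and> (LINT x|lborel. \<bar>f x - g x\<bar>) \<le> e \<and>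
        (\<lambda>n. LINT x|lborel. \<bar>g (x + s n) - g x\<bar>) \<longlonglongrightarrow> 0"
      using lim.hyps(1) lim.IH by blast
  qed
qed

subsection \<open>Weak derivatives and difference quotients\<close>

text \<open>The fundamental lemma of the calculus of variations. Test functions approximate
  indicators of boxes, so the integral of \<open>f\<close> over each small box vanishes, which
  forces \<open>f\<close> to vanish almost everywhere.\<close>

lemma AE_eq_0_if_weakly_0:
  fixes f :: "'a::euclidean_space \<Rightarrow> real"
  assumes \<Omega>: "open \<Omega>" and f: "f \<in> L1_loc \<Omega>"
    and weak: "\<And>\<psi>. \<psi> \<in> C1c \<Omega> \<Longrightarrow> (LINT x|lebesgue_on \<Omega>. f x * \<psi> x) = 0"
  shows "AE x in lebesgue_on \<Omega>. f x = 0"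
proof -
  have [simp]: "\<Omega> \<in> sets lebesgue" using \<Omega> by auto
  \<comment> \<open>As \<open>f\<close> is only locally integrable, the argument is run inside one
    closed box at a time; countably many of them cover \<Omega>.\<close>
  have box: "AE x in lebesgue. x \<in> box a b \<longrightarrow> f x = 0" if sub: "cbox a b \<subseteq> \<Omega>" for a b
  proof -
    have fi: "integrable lebesgue (\<lambda>x. indicator (cbox a b) x * f x)"
    proof -
      have "integrable (lebesgue_on (cbox a b)) f" using f sub by (auto simp: L1_loc_def)
      then show ?thesis by (subst (asm) integrable_restrict_space) auto
    qed
    define f1 where "f1 x = indicator (box a b) x * f x" for x
    have f1: "integrable lebesgue f1"
    proof -
      have "integrable lebesgue (\<lambda>x. indicator (box a b) x *\<^sub>R (indicator (cbox a b) x * f x))"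
        by (rule integrable_mult_indicator[OF _ fi]) simp
      moreover have "(\<lambda>x. indicator (box a b) x *\<^sub>R (indicator (cbox a b) x * f x)) = f1"
        using box_subset_cbox[of a b] by (auto simp: f1_def fun_eq_iff indicator_def)
      ultimately show ?thesis by simp
    qed
    \<comment> \<open>A Borel representative is chosen because the vanishing of integrals is
      extended over Borel sets and then used with \<open>lborel\<close>.\<close>
    obtain f2 where f2[measurable]: "f2 \<in> borel_measurable lborel" and "AE x in lborel. f1 x = f2 x"
      using completion_ex_borel_measurable_real[of f1 lborel] f1 by auto
    then have eq: "AE x in lebesgue. f1 x = f2 x" by (simp add: AE_completion)
    have "integrable lebesgue f2"
      using f1 eq by (subst integrable_cong_AE[of f2 lebesgue f1])
        (auto simp: measurable_completion elim: eventually_mono)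
    then have f2i: "integrable lborel f2" by (simp add: integrable_completion)
    have box0: "(LINT x|lborel. indicator (box c d) x * f2 x) = 0" for c d
    proof -
      \<comment> \<open>Cutting the test box down to the fixed one keeps its closure inside
        \<Omega>, where approximating test functions exist.\<close>
      obtain p q where pq: "box a b \<inter> box c d = box p q" "cbox a b \<inter> cbox c d = cbox p q"
        using box_Int_box[of a b c d] Int_interval[of a b c d] by blast
      then have sub': "cbox p q \<subseteq> \<Omega>" using sub by blast
      obtain \<psi> where \<psi>: "\<And>n::nat. \<psi> n \<in> C1c \<Omega>" "\<And>n x. \<bar>\<psi> n x\<bar> \<le> indicator (cbox p q) x"
          "\<And>x. (\<lambda>n. \<psi> n x) \<longlonglongrightarrow> indicator (box p q) x"
        using C1c_approx_box[OF sub'] by blast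
      have z: "\<psi> n x = 0" if "x \<notin> cbox a b" for n x
      proof -
        have "x \<notin> cbox p q" using that pq(2) by blast
        then show ?thesis using \<psi>(2)[of n x] by simp
      qed
      have b1: "\<bar>\<psi> n x\<bar> \<le> 1" for n x using \<psi>(2)[of n x] by (cases "x \<in> cbox p q") auto
      have [measurable]: "\<psi> n \<in> borel_measurable lebesgue" for n
        using borel_measurable_continuous_onI[OF C1c_continuous[OF \<psi>(1)]] by (simp add: measurable_completion)
      have "(\<lambda>n. LINT x|lebesgue. (indicator (cbox a b) x * f x) * \<psi> n x) \<longlonglongrightarrow>
          (LINT x|lebesgue. (indicator (cbox a b) x * f x) * indicator (box p q) x)"
      proof (rule integral_dominated_convergence[where w="\<lambda>x. \<bar>indicator (cbox a b) x * f x\<bar>"])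
        show "AE x in lebesgue. norm ((indicator (cbox a b) x * f x) * \<psi> n x) \<le> \<bar>indicator (cbox a b) x * f x\<bar>" for n
          using b1[of n] by (intro AE_I2) (simp add: abs_mult mult_left_le)
        show "AE x in lebesgue. (\<lambda>n. (indicator (cbox a b) x * f x) * \<psi> n x) \<longlonglongrightarrow> (indicator (cbox a b) x * f x) * indicator (box p q) x"
          by (intro AE_I2 tendsto_intros \<psi>(3))
        show "(\<lambda>x. indicator (cbox a b) x * f x * indicator (box p q) x) \<in> borel_measurable lebesgue"
          by (rule borel_measurable_times[OF borel_measurable_integrable[OF fi]]) (rule borel_measurable_indicator, simp)
        show "(\<lambda>x. indicator (cbox a b) x * f x * \<psi> n x) \<in> borel_measurable lebesgue" for n
          by (rule borel_measurable_times[OF borel_measurable_integrable[OF fi]]) auto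
      qed (use fi in auto)
      moreover have "(LINT x|lebesgue. (indicator (cbox a b) x * f x) * \<psi> n x) = 0" for n
      proof -
        have "(LINT x|lebesgue. (indicator (cbox a b) x * f x) * \<psi> n x) = (LINT x|lebesgue_on \<Omega>. f x * \<psi> n x)"
          using z subsetD[OF sub]
          by (subst integral_restrict_space) (auto intro!: Bochner_Integration.integral_cong simp: indicator_def)
        then show ?thesis using weak \<psi>(1) by simp
      qed
      ultimately have "(LINT x|lebesgue. (indicator (cbox a b) x * f x) * indicator (box p q) x) = 0"
        by (simp add: LIMSEQ_const_iff)
      also have "(\<lambda>x. (indicator (cbox a b) x * f x) * indicator (box p q) x) = (\<lambda>x. indicator (box c d) x * f1 x)"
        using pq(1) box_subset_cbox[of a b] by (auto simp: f1_def fun_eq_iff indicator_def)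
      also have "(LINT x|lebesgue. indicator (box c d) x * f1 x) = (LINT x|lebesgue. indicator (box c d) x * f2 x)"
        using f1 eq by (intro integral_cong_AE borel_measurable_times) (auto simp: measurable_completion elim: eventually_mono)
      also have "\<dots> = (LINT x|lborel. indicator (box c d) x * f2 x)" by (simp add: integral_completion)
      finally show ?thesis .
    qed
    have "AE x in lborel. f2 x = 0"
      using integral_vimage_borel_eq_0[OF f2i, of "\<lambda>x. x"] box0
      by (intro sigma_finite_measure.density_zero[OF sigma_finite_lborel f2i]) (simp add: set_lebesgue_integral_def)
    then have "AE x in lebesgue. f2 x = 0" by (rule AE_completion)
    with eq show ?thesis by eventually_elim (simp add: f1_def indicator_def split: if_splits)
  qed
  obtain \<D> where \<D>: "countable \<D>" "\<D> \<subseteq> Pow \<Omega>" "\<And>X. X \<in> \<D> \<Longrightarrow> \<exists>a b. X = cbox a b" "\<Union>\<D> = \<Omega>"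
    using open_countable_Union_open_cbox[OF \<Omega>] by metis
  have "AE x in lebesgue. x \<in> X \<longrightarrow> f x = 0" if "X \<in> \<D>" for X
  proof -
    have "\<exists>a b. X = cbox a b" using \<D>(3) that by blast
    then obtain a b where X: "X = cbox a b" by blast
    \<comment> \<open>The vanishing is known on open boxes while the cover consists of closed ones;
      the faces are negligible.\<close>
    have "AE x in lebesgue. x \<notin> cbox a b - box a b"
      by (rule AE_not_in) (simp add: negligible_iff_null_sets[symmetric] negligible_frontier_interval)
    moreover have "cbox a b \<subseteq> \<Omega>" using X \<D> that by blast
    then have "AE x in lebesgue. x \<in> box a b \<longrightarrow> f x = 0" by (rule box)
    ultimately show ?thesis by eventually_elim (auto simp: X)
  qed
  then have "AE x in lebesgue. \<forall>X\<in>\<D>. x \<in> X \<longrightarrow> f x = 0"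
    by (subst AE_ball_countable[OF \<D>(1)]) blast
  then have "AE x in lebesgue. x \<in> \<Omega> \<longrightarrow> f x = 0"
    by eventually_elim (use \<D>(4) in blast)
  then show ?thesis by (simp add: AE_restrict_space_iff)
qed

corollary AE_lborel_eq_0_if_weakly_0:
  fixes f :: "'a::euclidean_space \<Rightarrow> real"
  assumes f: "integrable lborel f"
    and weak: "\<And>\<psi>. \<psi> \<in> C1c UNIV \<Longrightarrow> (LINT x|lborel. f x * \<psi> x) = 0"
  shows "AE x in lborel. f x = 0"
proof -
  have [measurable]: "f \<in> borel_measurable borel" using f by auto
  have "integrable lebesgue f" using f by (simp add: integrable_completion)
  then have "f \<in> L1_loc UNIV"
    by (auto simp: L1_loc_def integrable_restrict_space borel_compact intro!: integrable_mult_indicator[where 'b=real, simplified])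
  moreover have "(LINT x|lebesgue_on UNIV. f x * \<psi> x) = 0" if \<psi>: "\<psi> \<in> C1c UNIV" for \<psi>
  proof -
    have [measurable]: "\<psi> \<in> borel_measurable borel"
      using C1c_continuous[OF \<psi>] by (rule borel_measurable_continuous_onI)
    show ?thesis using weak[OF \<psi>] by (simp add: integral_restrict_space integral_completion)
  qed
  ultimately have "AE x in lebesgue_on UNIV. f x = 0" by (intro AE_eq_0_if_weakly_0) auto
  then have "AE x in lebesgue. f x = 0" by (simp add: AE_restrict_space_iff)
  then show ?thesis unfolding AE_completion_iff .
qed

section \<open>Differences of weakly differentiable functions as integrals along segments\<close>

lemma C1_gradient_FTC:
  assumes D: "C1_gradient \<psi> D"
  shows "(LINT t|lborel. indicator {0..1::real} t * (D (x + t *\<^sub>R v) \<bullet> v)) = \<psi> (x + v) - \<psi> x"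
proof -
  have "(LINT t|lborel. (D (x + t *\<^sub>R v) \<bullet> v) * indicator {0..1::real} t) = \<psi> (x + 1 *\<^sub>R v) - \<psi> (x + 0 *\<^sub>R v)"
  proof (rule integral_FTC_Icc_real)
    fix t :: real
    have "((\<lambda>t. \<psi> (x + t *\<^sub>R v)) has_derivative (\<lambda>h. D (x + t *\<^sub>R v) \<bullet> (h *\<^sub>R v))) (at t)"
      by (rule has_derivative_compose[of "\<lambda>t. x + t *\<^sub>R v" "\<lambda>h. h *\<^sub>R v" t UNIV \<psi>])
        (use D in \<open>auto simp: C1_gradient_def intro!: derivative_eq_intros\<close>)
    then show "((\<lambda>t. \<psi> (x + t *\<^sub>R v)) has_real_derivative D (x + t *\<^sub>R v) \<bullet> v) (at t)"
      unfolding has_field_derivative_def by (rule has_derivative_eq_rhs) (simp add: fun_eq_iff)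
    have "continuous_on UNIV D" using D by (simp add: C1_gradient_def)
    then have "continuous_on UNIV (\<lambda>t. D (x + t *\<^sub>R v) \<bullet> v)"
      by (auto intro!: continuous_on_compose2[where g=D and t=UNIV] continuous_intros)
    then show "isCont (\<lambda>t. D (x + t *\<^sub>R v) \<bullet> v) t" by (simp add: continuous_on_eq_continuous_at)
  qed simp
  then show ?thesis by (simp add: mult.commute)
qed

text \<open>A general direction \<open>v\<close> is allowed, not just a basis vector, so that a
  difference with step \<open>h\<close> is the case of the direction
  \<open>h *\<^sub>R v\<close>.\<close>

definition weak_directional_derivative ::
    "'a::euclidean_space \<Rightarrow> ('a \<Rightarrow> real) \<Rightarrow> ('a \<Rightarrow> real) \<Rightarrow> bool" where
  "weak_directional_derivative v U g \<longleftrightarrow> (\<forall>\<psi>\<in>C1c UNIV. \<forall>D. C1_gradient \<psi> D \<longrightarrow>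
     (LINT x|lborel. U x * (D x \<bullet> v)) = - (LINT x|lborel. g x * \<psi> x))"

lemma weak_directional_derivative_scale:
  assumes "weak_directional_derivative v U g"
  shows "weak_directional_derivative (h *\<^sub>R v) U (\<lambda>x. h * g x)"
  using assms by (simp add: weak_directional_derivative_def mult.left_commute mult.assoc)

text \<open>Every slice in \<open>x\<close> is a translate of \<open>f\<close>, with the same L^1
  norm, and \<open>t\<close> ranges over a set of measure 1. This licenses each exchange of the
  integrals over \<open>x\<close> and over segments.\<close>

lemma integrable_shear:
  fixes f :: "'a::euclidean_space \<Rightarrow> real"
  assumes f: "integrable lborel f"
  shows "integrable (lborel \<Otimes>\<^sub>M lborel) (\<lambda>(t, x). indicator {0..1::real} t * f (x + t *\<^sub>R v))"
proof (rule lborel_pair.Fubini_integrable)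
  have [measurable]: "f \<in> borel_measurable borel" using f by auto
  show "(\<lambda>(t, x). indicator {0..1::real} t * f (x + t *\<^sub>R v)) \<in> borel_measurable (lborel \<Otimes>\<^sub>M lborel)"
    by measurable
  have "(LINT x|lborel. norm (indicator {0..1::real} t * f (x + t *\<^sub>R v))) = indicator {0..1::real} t * (LINT x|lborel. \<bar>f x\<bar>)" for t
    using integral_lborel_translate[of "\<lambda>x. \<bar>f x\<bar>" "t *\<^sub>R v"] by (simp add: abs_mult)
  then show "integrable lborel (\<lambda>t. LINT x|lborel. norm (case (t, x) of (t, x) \<Rightarrow> indicator {0..1::real} t * f (x + t *\<^sub>R v)))"
    by simp
  show "AE t in lborel. integrable lborel (\<lambda>x. case (t, x) of (t, x) \<Rightarrow> indicator {0..1::real} t * f (x + t *\<^sub>R v))"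
    using integrable_lborel_translate[OF f] by simp
qed

lemma integrable_pair_lborel_mult_bounded:
  fixes f b :: "real \<times> 'a::euclidean_space \<Rightarrow> real"
  assumes "integrable (lborel \<Otimes>\<^sub>M lborel) f" "b \<in> borel_measurable borel" "\<And>z. \<bar>b z\<bar> \<le> B"
  shows "integrable (lborel \<Otimes>\<^sub>M lborel) (\<lambda>z. f z * b z)"
proof (rule Bochner_Integration.integrable_bound)
  show "integrable (lborel \<Otimes>\<^sub>M lborel) (\<lambda>z. B * f z)" using assms(1) by simp
  have "b \<in> borel_measurable (lborel \<Otimes>\<^sub>M lborel)" using assms(2) by (simp add: lborel_prod)
  then show "(\<lambda>z. f z * b z) \<in> borel_measurable (lborel \<Otimes>\<^sub>M lborel)" using assms(1) by auto
  have "B \<ge> 0" using assms(3)[of undefined] by linarith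
  then show "AE z in lborel \<Otimes>\<^sub>M lborel. norm (f z * b z) \<le> norm (B * f z)"
    using assms(3) by (intro AE_I2) (simp add: abs_mult mult.commute[of B] mult_left_mono)
qed

text \<open>The fundamental theorem along segments, almost everywhere. Tested against
  \<open>\<psi>\<close>, the translations and the derivative move onto \<open>\<psi>\<close>, where
  the classical theorem applies along \<open>- v\<close>; the fundamental lemma then removes
  \<open>\<psi>\<close>.\<close>

lemma weak_directional_derivative_difference:
  fixes U g :: "'a::euclidean_space \<Rightarrow> real"
  assumes U: "integrable lborel U" and g: "integrable lborel g"
    and weak: "weak_directional_derivative v U g"
  shows "AE x in lborel. U (x + v) - U x = (LINT t|lborel. indicator {0..1} t * g (x + t *\<^sub>R v))"
proof -
  have [measurable]: "U \<in> borel_measurable borel" "g \<in> borel_measurable borel" using U g by auto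
  define A where "A x = (LINT t|lborel. indicator {0..1} t * g (x + t *\<^sub>R v))" for x
  have A: "integrable lborel A"
    unfolding A_def using lborel_pair.integrable_snd[OF integrable_shear[OF g]] .
  have Uv: "integrable lborel (\<lambda>x. U (x + v))" by (rule integrable_lborel_translate[OF U])
  have "AE x in lborel. (U (x + v) - U x) - A x = 0"
  proof (rule AE_lborel_eq_0_if_weakly_0)
    show "integrable lborel (\<lambda>x. U (x + v) - U x - A x)" using U Uv A by simp
    fix \<psi> :: "'a \<Rightarrow> real" assume \<psi>: "\<psi> \<in> C1c UNIV"
    obtain D where D: "C1_gradient \<psi> D" using \<psi> by (auto simp: C1c_iff)
    obtain B where B: "\<And>x. \<bar>\<psi> x\<bar> \<le> B" "\<And>x. norm (D x) \<le> B" using C1c_boundedE[OF \<psi> D] by metis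
    have cont: "continuous_on UNIV \<psi>" "continuous_on UNIV D"
      using D C1_gradient_continuous by (auto simp: C1_gradient_def)
    have [measurable]: "\<psi> \<in> borel_measurable borel" "D \<in> borel_measurable borel"
      using cont by (auto intro: borel_measurable_continuous_onI)
    have mult_int: "integrable lborel (\<lambda>x. f x * \<psi> (x + c))" if "integrable lborel f" for f c
    proof (rule Bochner_Integration.integrable_bound)
      show "integrable lborel (\<lambda>x. B * f x)" using that by simp
      show "AE x in lborel. norm (f x * \<psi> (x + c)) \<le> norm (B * f x)"
        using B(1) by (intro AE_I2) (simp add: abs_mult mult.commute[of B] mult_left_mono order_trans[OF B(1) abs_ge_self])
    qed (use that in auto)
    have 1: "(LINT x|lborel. A x * \<psi> x) = (LINT t|lborel. LINT x|lborel. indicator {0..1} t * g (x + t *\<^sub>R v) * \<psi> x)"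
    proof -
      have "integrable (lborel \<Otimes>\<^sub>M lborel) (\<lambda>z. (case z of (t, x) \<Rightarrow> indicator {0..1::real} t * g (x + t *\<^sub>R v)) * \<psi> (snd z))"
        by (rule integrable_pair_lborel_mult_bounded[OF integrable_shear[OF g], of _ B])
          (auto intro!: borel_measurable_continuous_onI continuous_on_compose2[OF cont(1)] continuous_intros B)
      then have "integrable (lborel \<Otimes>\<^sub>M lborel) (\<lambda>(t::real, x). indicator {0..1} t * g (x + t *\<^sub>R v) * \<psi> x)"
        by (simp add: case_prod_beta')
      from lborel_pair.Fubini_integral[OF this]
      have "(LINT x|lborel. LINT t|lborel. indicator {0..1::real} t * g (x + t *\<^sub>R v) * \<psi> x) =
        (LINT t|lborel. LINT x|lborel. indicator {0..1} t * g (x + t *\<^sub>R v) * \<psi> x)" .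
      then show ?thesis by (simp only: A_def integral_mult_left_zero)
    qed
    have 2: "(LINT x|lborel. indicator {0..1} t * g (x + t *\<^sub>R v) * \<psi> x) =
        - (LINT x|lborel. U x * (indicator {0..1} t * (D (x - t *\<^sub>R v) \<bullet> v)))" for t :: real
    proof -
      have "(LINT x|lborel. g (x + t *\<^sub>R v) * \<psi> x) = (LINT x|lborel. g x * \<psi> (x + (- t *\<^sub>R v)))"
        using integral_lborel_translate[of "\<lambda>x. g x * \<psi> (x + (- t *\<^sub>R v))" "t *\<^sub>R v"] by simp
      also have "\<dots> = - (LINT x|lborel. U x * (D (x + (- t *\<^sub>R v)) \<bullet> v))"
        using weak C1c_translate[OF \<psi>, of "- t *\<^sub>R v"] C1_gradient_translate[OF D, of "- t *\<^sub>R v"]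
        unfolding weak_directional_derivative_def by simp
      finally show ?thesis
        by (cases "t \<in> {0..1}") (simp_all add: mult.assoc)
    qed
    have 3: "(LINT t|lborel. LINT x|lborel. U x * (indicator {0..1} t * (D (x - t *\<^sub>R v) \<bullet> v))) =
        (LINT x|lborel. LINT t|lborel. U x * (indicator {0..1::real} t * (D (x - t *\<^sub>R v) \<bullet> v)))"
    proof -
      \<comment> \<open>The shear by the zero vector gives the integrability of \<open>U\<close> on
        the product with the unit interval.\<close>
      have "integrable (lborel \<Otimes>\<^sub>M lborel) (\<lambda>z. (case z of (t::real, x) \<Rightarrow> indicator {0..1} t * U (x + t *\<^sub>R 0)) * (D (snd z - fst z *\<^sub>R v) \<bullet> v))"
      proof (rule integrable_pair_lborel_mult_bounded[OF integrable_shear[OF U]])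
        show "(\<lambda>z. D (snd z - fst z *\<^sub>R v) \<bullet> v) \<in> borel_measurable borel"
          by (auto intro!: borel_measurable_continuous_onI continuous_on_compose2[OF cont(2)] continuous_intros)
        show "\<bar>D (snd z - fst z *\<^sub>R v) \<bullet> v\<bar> \<le> B * norm v" for z
          using Cauchy_Schwarz_ineq2 B(2) by (meson mult_right_mono norm_ge_zero order_trans)
      qed
      then have "integrable (lborel \<Otimes>\<^sub>M lborel) (\<lambda>(t::real, x). U x * (indicator {0..1} t * (D (x - t *\<^sub>R v) \<bullet> v)))"
        by (simp add: case_prod_beta' mult_ac)
      from lborel_pair.Fubini_integral[OF this] show ?thesis by simp
    qed
    have 4: "(LINT t|lborel. indicator {0..1::real} t * (D (x - t *\<^sub>R v) \<bullet> v)) = \<psi> x - \<psi> (x - v)" for x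
      using C1_gradient_FTC[OF D, of x "- v"] by simp
    have "(LINT x|lborel. A x * \<psi> x) = - (LINT x|lborel. U x * (\<psi> x - \<psi> (x - v)))"
      unfolding 1 2 by (simp add: 3 4)
    also have "\<dots> = (LINT x|lborel. U x * \<psi> (x + - v)) - (LINT x|lborel. U x * \<psi> x)"
      using mult_int[OF U, of "- v"] mult_int[OF U, of 0] by (simp add: right_diff_distrib)
    also have "(LINT x|lborel. U x * \<psi> (x + - v)) = (LINT x|lborel. U (x + v) * \<psi> x)"
      using integral_lborel_translate[of "\<lambda>x. U x * \<psi> (x + - v)" v] by simp
    finally show "(LINT x|lborel. (U (x + v) - U x - A x) * \<psi> x) = 0"
      using mult_int[OF U, of 0] mult_int[OF Uv, of 0] mult_int[OF A, of 0] by (simp add: left_diff_distrib)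
  qed
  then show ?thesis by (simp add: A_def)
qed

text \<open>The quotient minus \<open>g\<close> is the average over \<open>t\<close> in [0,1] of
  \<open>g (x + t *\<^sub>R (h n *\<^sub>R v)) - g x\<close>. Its L^1 norm is at most the average of
  the L^1 modulus of continuity \<open>\<omega>\<close>, which tends to 0 pointwise and is bounded
  by twice the norm of \<open>g\<close>.\<close>

lemma L1_difference_quotient_limit:
  fixes U g :: "'a::euclidean_space \<Rightarrow> real"
  assumes U: "integrable lborel U" and g: "integrable lborel g"
    and weak: "weak_directional_derivative v U g"
  shows "(\<lambda>n. LINT x|lborel. \<bar>real (Suc n) * (U (x + (1 / real (Suc n)) *\<^sub>R v) - U x) - g x\<bar>) \<longlonglongrightarrow> 0"
proof (rule tendsto_sandwich[OF _ _ tendsto_const])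
  define h where "h n = 1 / real (Suc n)" for n
  have h: "h n > 0" "real (Suc n) = 1 / h n" for n by (auto simp: h_def)
  have h0: "h \<longlonglongrightarrow> 0"
    unfolding h_def using LIMSEQ_inverse_real_of_nat by (simp add: inverse_eq_divide)
  have gm[measurable]: "g \<in> borel_measurable borel" using g by auto
  define \<omega> where "\<omega> w = (LINT x|lborel. \<bar>g (x + w) - g x\<bar>)" for w
  note gt = integrable_lborel_translate[OF g]
  have \<omega>0: "0 \<le> \<omega> w" for w by (simp add: \<omega>_def)
  have \<omega>_le: "\<omega> w \<le> 2 * (LINT x|lborel. \<bar>g x\<bar>)" for w
  proof -
    have "\<omega> w \<le> (LINT x|lborel. \<bar>g (x + w)\<bar> + \<bar>g x\<bar>)"
      unfolding \<omega>_def using g gt by (intro integral_mono) auto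
    also have "\<dots> = (LINT x|lborel. \<bar>g (x + w)\<bar>) + (LINT x|lborel. \<bar>g x\<bar>)" using g gt by simp
    also have "(LINT x|lborel. \<bar>g (x + w)\<bar>) = (LINT x|lborel. \<bar>g x\<bar>)"
      by (rule integral_lborel_translate) simp
    finally show ?thesis by simp
  qed
  \<comment> \<open>The second part is Minkowski's integral inequality. The first also provides the
    measurability of \<open>\<omega>\<close> along a ray, needed for dominated convergence.\<close>
  have bound: "integrable lborel (\<lambda>t. indicator {0..1::real} t * \<omega> (t *\<^sub>R w)) \<and>
    (LINT x|lborel. \<bar>LINT t|lborel. indicator {0..1::real} t * (g (x + t *\<^sub>R w) - g x)\<bar>) \<le>
      (LINT t|lborel. indicator {0..1::real} t * \<omega> (t *\<^sub>R w))" for w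
  proof -
    let ?F = "\<lambda>(t, x). indicator {0..1::real} t * (g (x + t *\<^sub>R w) - g x)"
    have "integrable (lborel \<Otimes>\<^sub>M lborel) (\<lambda>z. (case z of (t, x) \<Rightarrow> indicator {0..1::real} t * g (x + t *\<^sub>R w))
        - (case z of (t, x) \<Rightarrow> indicator {0..1::real} t * g (x + t *\<^sub>R 0)))"
      by (intro Bochner_Integration.integrable_diff integrable_shear g)
    then have F: "integrable (lborel \<Otimes>\<^sub>M lborel) ?F"
      by (simp add: case_prod_beta' right_diff_distrib)
    then have "integrable (lborel \<Otimes>\<^sub>M lborel) (\<lambda>z. \<bar>?F z\<bar>)" by (rule integrable_abs)
    then have aF: "integrable (lborel \<Otimes>\<^sub>M lborel) (\<lambda>(t, x). \<bar>indicator {0..1::real} t * (g (x + t *\<^sub>R w) - g x)\<bar>)"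
      by (simp add: case_prod_beta')
    have inner: "(LINT x|lborel. \<bar>indicator {0..1::real} t * (g (x + t *\<^sub>R w) - g x)\<bar>) = indicator {0..1} t * \<omega> (t *\<^sub>R w)" for t
      by (simp add: \<omega>_def abs_mult)
    have 1: "integrable lborel (\<lambda>t. indicator {0..1::real} t * \<omega> (t *\<^sub>R w))"
      using lborel_pair.integrable_fst[OF aF] unfolding inner .
    have "(LINT x|lborel. \<bar>LINT t|lborel. indicator {0..1::real} t * (g (x + t *\<^sub>R w) - g x)\<bar>) \<le>
        (LINT x|lborel. LINT t|lborel. \<bar>indicator {0..1::real} t * (g (x + t *\<^sub>R w) - g x)\<bar>)"
      using lborel_pair.integrable_snd[OF F] lborel_pair.integrable_snd[OF aF]
      by (intro integral_mono integrable_abs integral_abs_bound)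
    also have "\<dots> = (LINT t|lborel. indicator {0..1::real} t * \<omega> (t *\<^sub>R w))"
      using lborel_pair.Fubini_integral[OF aF] unfolding inner .
    finally show ?thesis using 1 by blast
  qed
  show "\<forall>\<^sub>F n in sequentially. (LINT x|lborel. \<bar>real (Suc n) * (U (x + (1 / real (Suc n)) *\<^sub>R v) - U x) - g x\<bar>)
      \<le> (LINT t|lborel. indicator {0..1::real} t * \<omega> (t *\<^sub>R (h n *\<^sub>R v)))"
  proof (rule always_eventually, rule allI)
    fix n
    let ?w = "h n *\<^sub>R v"
    have "AE x in lborel. U (x + ?w) - U x = (LINT t|lborel. indicator {0..1::real} t * (h n * g (x + t *\<^sub>R ?w)))"
      by (rule weak_directional_derivative_difference[OF U _ weak_directional_derivative_scale[OF weak]])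
        (use g in simp)
    moreover have "AE x in lborel. integrable lborel (\<lambda>t. indicator {0..1::real} t * g (x + t *\<^sub>R ?w))"
      using lborel_pair.AE_integrable_snd[OF integrable_shear[OF g, of ?w]] by simp
    ultimately have "AE x in lborel. real (Suc n) * (U (x + ?w) - U x) - g x =
        (LINT t|lborel. indicator {0..1::real} t * (g (x + t *\<^sub>R ?w) - g x))"
    proof eventually_elim
      fix x
      assume 1: "U (x + ?w) - U x = (LINT t|lborel. indicator {0..1::real} t * (h n * g (x + t *\<^sub>R ?w)))"
        and 2: "integrable lborel (\<lambda>t. indicator {0..1::real} t * g (x + t *\<^sub>R ?w))"
      have "U (x + ?w) - U x = h n * (LINT t|lborel. indicator {0..1::real} t * g (x + t *\<^sub>R ?w))"
        unfolding 1 by (subst integral_mult_right_zero[symmetric]) (simp add: mult.left_commute)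
      then have "real (Suc n) * (U (x + ?w) - U x) - g x =
          (LINT t|lborel. indicator {0..1::real} t * g (x + t *\<^sub>R ?w)) - (LINT t|lborel. indicator {0..1::real} t * g x)"
        using h[of n] by (simp del: of_nat_Suc)
      also have "\<dots> = (LINT t|lborel. indicator {0..1::real} t * (g (x + t *\<^sub>R ?w) - g x))"
        unfolding right_diff_distrib using 2
        by (intro Bochner_Integration.integral_diff[symmetric]) auto
      finally show "real (Suc n) * (U (x + ?w) - U x) - g x =
        (LINT t|lborel. indicator {0..1::real} t * (g (x + t *\<^sub>R ?w) - g x))" .
    qed
    then have "(LINT x|lborel. \<bar>real (Suc n) * (U (x + ?w) - U x) - g x\<bar>) =
        (LINT x|lborel. \<bar>LINT t|lborel. indicator {0..1::real} t * (g (x + t *\<^sub>R ?w) - g x)\<bar>)"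
      using U by (intro integral_cong_AE) (auto elim: eventually_mono)
    with bound[of ?w] show "(LINT x|lborel. \<bar>real (Suc n) * (U (x + (1 / real (Suc n)) *\<^sub>R v) - U x) - g x\<bar>)
      \<le> (LINT t|lborel. indicator {0..1::real} t * \<omega> (t *\<^sub>R (h n *\<^sub>R v)))" by (simp add: h_def)
  qed
  have "(\<lambda>n. LINT t|lborel. indicator {0..1::real} t * \<omega> (t *\<^sub>R (h n *\<^sub>R v))) \<longlonglongrightarrow> (LINT t::real|lborel. 0)"
  proof (rule integral_dominated_convergence[where w="\<lambda>t. indicator {0..1::real} t * (2 * (LINT x|lborel. \<bar>g x\<bar>))"])
    show "AE t in lborel. (\<lambda>n. indicator {0..1::real} t * \<omega> (t *\<^sub>R (h n *\<^sub>R v))) \<longlonglongrightarrow> 0"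
    proof (rule AE_I2)
      fix t :: real
      have "(\<lambda>n. t *\<^sub>R (h n *\<^sub>R v)) \<longlonglongrightarrow> t *\<^sub>R (0 *\<^sub>R v)" by (intro tendsto_intros h0)
      then have "(\<lambda>n. \<omega> (t *\<^sub>R (h n *\<^sub>R v))) \<longlonglongrightarrow> 0"
        unfolding \<omega>_def using L1_translation_limit[OF g] by simp
      from tendsto_mult_right_zero[OF this] show "(\<lambda>n. indicator {0..1::real} t * \<omega> (t *\<^sub>R (h n *\<^sub>R v))) \<longlonglongrightarrow> 0" .
    qed
    show "AE t in lborel. norm (indicator {0..1::real} t * \<omega> (t *\<^sub>R (h n *\<^sub>R v))) \<le> indicator {0..1::real} t * (2 * (LINT x|lborel. \<bar>g x\<bar>))" for n
      using \<omega>_le \<omega>0 by (intro AE_I2) (simp add: abs_mult mult_left_mono)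
    show "(\<lambda>t. indicator {0..1::real} t * \<omega> (t *\<^sub>R (h n *\<^sub>R v))) \<in> borel_measurable lborel" for n
      using bound by (blast intro: borel_measurable_integrable)
  qed auto
  then show "(\<lambda>n. LINT t|lborel. indicator {0..1::real} t * \<omega> (t *\<^sub>R (h n *\<^sub>R v))) \<longlonglongrightarrow> 0" by simp
qed simp

text \<open>The difference quotients of \<open>\<eta> (U)\<close>, for a primitive
  \<open>\<eta>\<close> of \<open>k\<close>, have integral 0. The claim follows by bounding their
  L^1 distance to \<open>k (U) * g\<close> and letting the step tend to 0 along a
  subsequence.\<close>

lemma integral_chain_rule_eq_0:
  fixes U g :: "'a::euclidean_space \<Rightarrow> real" and k :: "real \<Rightarrow> real"
  assumes U: "integrable lborel U" and g: "integrable lborel g"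
    and weak: "weak_directional_derivative v U g"
    and k1: "\<And>t. \<bar>k t\<bar> \<le> 1" and kL: "\<And>s t. \<bar>k s - k t\<bar> \<le> L * \<bar>s - t\<bar>"
  shows "(LINT x|lborel. k (U x) * g x) = 0"
proof -
  have [measurable]: "U \<in> borel_measurable borel" "g \<in> borel_measurable borel" using U g by auto
  have L0: "L \<ge> 0" using kL[of 1 0] by simp
  have kc: "continuous_on UNIV k"
  proof (rule lipschitz_on_continuous_on)
    show "L-lipschitz_on UNIV k" using kL L0 by (auto simp: lipschitz_on_def dist_real_def)
  qed
  then have [measurable]: "k \<in> borel_measurable borel" by (rule borel_measurable_continuous_onI)
  have "\<exists>F. \<forall>x :: real. -\<infinity> < ereal x \<longrightarrow> ereal x < \<infinity> \<longrightarrow> (F has_vector_derivative k x) (at x)"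
    using kc by (intro einterval_antiderivative) (auto simp: continuous_on_eq_continuous_at)
  then obtain \<eta> where \<eta>: "\<And>t. (\<eta> has_real_derivative k t) (at t)"
    by (auto simp: has_real_derivative_iff_has_vector_derivative)
  have mvt: "\<exists>z. \<bar>z - a\<bar> \<le> \<bar>b - a\<bar> \<and> \<eta> b - \<eta> a = (b - a) * k z" for a b
  proof (cases a b rule: linorder_cases)
    case less
    from MVT2[OF this \<eta>] obtain z where "a < z" "z < b" "\<eta> b - \<eta> a = (b - a) * k z" by blast
    then show ?thesis by (intro exI[of _ z]) auto
  next
    case greater
    from MVT2[OF this \<eta>] obtain z where "b < z" "z < a" "\<eta> a - \<eta> b = (a - b) * k z" by blast
    then show ?thesis by (intro exI[of _ z]) (auto simp: algebra_simps)
  qed auto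
  have \<eta>1: "\<bar>\<eta> b - \<eta> a\<bar> \<le> \<bar>b - a\<bar>" for a b
    using mvt[of a b] k1 by (auto simp: abs_mult mult_left_le)
  \<comment> \<open>The Lipschitz bound alone would leave the square of an increment, which need not
    be integrable. The bound 2, from \<open>\<bar>k\<bar> \<le> 1\<close>, supplies the integrable
    majorant and \<open>L\<close> the convergence to 0.\<close>
  have taylor: "\<bar>\<eta> b - \<eta> a - k a * (b - a)\<bar> \<le> min 2 (L * \<bar>b - a\<bar>) * \<bar>b - a\<bar>" for a b
  proof -
    obtain z where z: "\<bar>z - a\<bar> \<le> \<bar>b - a\<bar>" "\<eta> b - \<eta> a = (b - a) * k z" using mvt by blast
    have "\<bar>k z - k a\<bar> \<le> 2" using k1[of z] k1[of a] by linarith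
    moreover have "\<bar>k z - k a\<bar> \<le> L * \<bar>b - a\<bar>" using kL[of z a] z(1) L0 by (meson mult_left_mono order_trans)
    moreover have "\<eta> b - \<eta> a - k a * (b - a) = (k z - k a) * (b - a)" using z(2) by (simp add: algebra_simps)
    ultimately show ?thesis by (simp add: abs_mult mult_right_mono)
  qed
  \<comment> \<open>Subtracting \<open>\<eta> 0\<close> gives
    \<open>\<bar>w\<bar> \<le> \<bar>U\<bar>\<close>, hence integrability on a space of infinite
    measure, and leaves differences unchanged.\<close>
  define w where "w x = \<eta> (U x) - \<eta> 0" for x
  have "\<eta> \<in> borel_measurable borel"
    by (intro borel_measurable_continuous_onI continuous_at_imp_continuous_on ballI DERIV_isCont[OF \<eta>])
  then have w_meas[measurable]: "w \<in> borel_measurable borel" unfolding w_def by measurable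
  have w: "integrable lborel w"
    using \<eta>1[of _ 0] by (intro Bochner_Integration.integrable_bound[OF U]) (auto simp: w_def)
  define h where "h n = 1 / real (Suc n)" for n
  have h: "h n > 0" for n by (simp add: h_def)
  define \<Delta> where "\<Delta> n x = U (x + h n *\<^sub>R v) - U x" for n x
  have Ut: "integrable lborel (\<lambda>x. U (x + c))" for c by (rule integrable_lborel_translate[OF U])
  have \<Delta>i: "integrable lborel (\<Delta> n)" for n unfolding \<Delta>_def using U Ut by simp
  define e where "e n = (LINT x|lborel. \<bar>\<Delta> n x / h n - g x\<bar>)" for n
  have e0: "e \<longlonglongrightarrow> 0"
    using L1_difference_quotient_limit[OF U g weak] by (simp add: e_def[abs_def] \<Delta>_def h_def mult.commute)
  have dom: "integrable lborel (\<lambda>x. min 2 (L * \<bar>\<Delta> n x\<bar>) * \<bar>g x\<bar>)" for n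
  proof (rule Bochner_Integration.integrable_bound[of _ "\<lambda>x. 2 * g x"])
    show "AE x in lborel. norm (min 2 (L * \<bar>\<Delta> n x\<bar>) * \<bar>g x\<bar>) \<le> norm (2 * g x)"
      using L0 by (intro AE_I2) (simp add: abs_mult mult_right_mono abs_of_nonneg)
    show "(\<lambda>x. min 2 (L * \<bar>\<Delta> n x\<bar>) * \<bar>g x\<bar>) \<in> borel_measurable lborel" unfolding \<Delta>_def by measurable
  qed (use g in auto)
  have kgi: "integrable lborel (\<lambda>x. k (U x) * g x)"
    using k1 by (intro Bochner_Integration.integrable_bound[OF g]) (auto simp: abs_mult mult_left_le_one_le)
  \<comment> \<open>The factor 3 is 1 for exchanging \<open>g\<close> and the quotient in
    \<open>k (U x) * g x\<close>, plus 2 for exchanging the quotient and \<open>g\<close> in the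
    remainder, where the minimum is at most 2.\<close>
  have bound: "\<bar>LINT x|lborel. k (U x) * g x\<bar> \<le> 3 * e n + (LINT x|lborel. min 2 (L * \<bar>\<Delta> n x\<bar>) * \<bar>g x\<bar>)" for n
  proof -
    note wt = integrable_lborel_translate[OF w, of "h n *\<^sub>R v"]
    have "(LINT x|lborel. w (x + h n *\<^sub>R v)) = (LINT x|lborel. w x)" by (rule integral_lborel_translate) simp
    then have "(LINT x|lborel. k (U x) * g x) = (LINT x|lborel. k (U x) * g x - (w (x + h n *\<^sub>R v) - w x) / h n)"
      using kgi w wt by simp
    also have "\<bar>\<dots>\<bar> \<le> (LINT x|lborel. \<bar>k (U x) * g x - (w (x + h n *\<^sub>R v) - w x) / h n\<bar>)"
      by (rule integral_abs_bound)
    also have "\<dots> \<le> (LINT x|lborel. 3 * \<bar>\<Delta> n x / h n - g x\<bar> + min 2 (L * \<bar>\<Delta> n x\<bar>) * \<bar>g x\<bar>)"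
    proof (rule integral_mono)
      fix x
      let ?d = "\<Delta> n x / h n" and ?m = "min 2 (L * \<bar>\<Delta> n x\<bar>)"
      have aux: "\<bar>G - W\<bar> \<le> 3 * c + q" if "s \<le> 2 * c + q" "\<bar>W - K\<bar> \<le> s" "\<bar>G - K\<bar> \<le> c"
        for G W K c q s :: real using that by linarith
      have m: "0 \<le> ?m" "?m \<le> 2" using L0 by auto
      have "w (x + h n *\<^sub>R v) - w x - k (U x) * \<Delta> n x = \<eta> (U (x + h n *\<^sub>R v)) - \<eta> (U x) - k (U x) * (U (x + h n *\<^sub>R v) - U x)"
        by (simp add: w_def \<Delta>_def)
      then have "\<bar>w (x + h n *\<^sub>R v) - w x - k (U x) * \<Delta> n x\<bar> \<le> ?m * \<bar>\<Delta> n x\<bar>"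
        using taylor[of "U (x + h n *\<^sub>R v)" "U x"] by (simp add: \<Delta>_def)
      then have "\<bar>w (x + h n *\<^sub>R v) - w x - k (U x) * \<Delta> n x\<bar> / h n \<le> ?m * \<bar>\<Delta> n x\<bar> / h n"
        using h[of n] by (intro divide_right_mono) auto
      moreover have "\<bar>w (x + h n *\<^sub>R v) - w x - k (U x) * \<Delta> n x\<bar> / h n = \<bar>(w (x + h n *\<^sub>R v) - w x) / h n - k (U x) * ?d\<bar>"
        using h[of n] by (simp add: diff_divide_distrib[symmetric])
      moreover have "?m * \<bar>\<Delta> n x\<bar> / h n = ?m * \<bar>?d\<bar>" using h[of n] by simp
      ultimately have 1: "\<bar>(w (x + h n *\<^sub>R v) - w x) / h n - k (U x) * ?d\<bar> \<le> ?m * \<bar>?d\<bar>" by simp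
      have "\<bar>k (U x) * g x - k (U x) * ?d\<bar> = \<bar>k (U x)\<bar> * \<bar>?d - g x\<bar>"
        by (simp add: abs_mult[symmetric] right_diff_distrib)
      also have "\<dots> \<le> 1 * \<bar>?d - g x\<bar>" using k1 by (intro mult_right_mono) auto
      finally have 2: "\<bar>k (U x) * g x - k (U x) * ?d\<bar> \<le> \<bar>?d - g x\<bar>" by simp
      have "?m * \<bar>?d\<bar> \<le> ?m * (\<bar>?d - g x\<bar> + \<bar>g x\<bar>)" using m by (intro mult_left_mono) auto
      also have "\<dots> \<le> 2 * \<bar>?d - g x\<bar> + ?m * \<bar>g x\<bar>"
        unfolding distrib_left using m by (intro add_mono mult_right_mono) auto
      finally show "\<bar>k (U x) * g x - (w (x + h n *\<^sub>R v) - w x) / h n\<bar> \<le> 3 * \<bar>?d - g x\<bar> + ?m * \<bar>g x\<bar>"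
        by (rule aux[OF _ 1 2])
    qed (use kgi w wt \<Delta>i g dom in auto)
    also have "\<dots> = 3 * e n + (LINT x|lborel. min 2 (L * \<bar>\<Delta> n x\<bar>) * \<bar>g x\<bar>)"
      using \<Delta>i g dom by (simp add: e_def)
    finally show ?thesis .
  qed
  have "h \<longlonglongrightarrow> 0" unfolding h_def using LIMSEQ_inverse_real_of_nat by (simp add: inverse_eq_divide)
  then have "(\<lambda>n. h n *\<^sub>R v) \<longlonglongrightarrow> 0 *\<^sub>R v" by (intro tendsto_intros)
  then have "(\<lambda>n. LINT x|lborel. norm (\<Delta> n x)) \<longlonglongrightarrow> 0"
    unfolding \<Delta>_def using L1_translation_limit[OF U, of "\<lambda>n. h n *\<^sub>R v"] by simp
  \<comment> \<open>L^1 convergence gives pointwise convergence only along a subsequence. This is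
    enough, since \<open>bound\<close> holds for every \<open>n\<close>.\<close>
  from tendsto_L1_AE_subseq[OF \<Delta>i this] obtain r :: "nat \<Rightarrow> nat"
    where r: "strict_mono r" "AE x in lborel. (\<lambda>n. \<Delta> (r n) x) \<longlonglongrightarrow> 0" by blast
  have "(\<lambda>n. LINT x|lborel. min 2 (L * \<bar>\<Delta> (r n) x\<bar>) * \<bar>g x\<bar>) \<longlonglongrightarrow> (LINT x::'a|lborel. 0)"
  proof (rule integral_dominated_convergence[where w="\<lambda>x. 2 * \<bar>g x\<bar>"])
    show "AE x in lborel. (\<lambda>n. min 2 (L * \<bar>\<Delta> (r n) x\<bar>) * \<bar>g x\<bar>) \<longlonglongrightarrow> 0"
      using r(2)
    proof eventually_elim
      fix x assume "(\<lambda>n. \<Delta> (r n) x) \<longlonglongrightarrow> 0"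
      then have "(\<lambda>n. min 2 (L * \<bar>\<Delta> (r n) x\<bar>) * \<bar>g x\<bar>) \<longlonglongrightarrow> min 2 (L * \<bar>0\<bar>) * \<bar>g x\<bar>"
        by (intro tendsto_intros)
      then show "(\<lambda>n. min 2 (L * \<bar>\<Delta> (r n) x\<bar>) * \<bar>g x\<bar>) \<longlonglongrightarrow> 0" by simp
    qed
    show "AE x in lborel. norm (min 2 (L * \<bar>\<Delta> (r n) x\<bar>) * \<bar>g x\<bar>) \<le> 2 * \<bar>g x\<bar>" for n
      using L0 by (intro AE_I2) (simp add: abs_mult mult_right_mono abs_of_nonneg)
  qed (use g dom in auto)
  moreover have "(\<lambda>n. 3 * e (r n)) \<longlonglongrightarrow> 3 * 0"
    using LIMSEQ_subseq_LIMSEQ[OF e0 r(1)] by (intro tendsto_intros) (simp add: o_def)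
  ultimately have "(\<lambda>n. 3 * e (r n) + (LINT x|lborel. min 2 (L * \<bar>\<Delta> (r n) x\<bar>) * \<bar>g x\<bar>)) \<longlonglongrightarrow> 0"
    using tendsto_add by fastforce
  then have "\<bar>LINT x|lborel. k (U x) * g x\<bar> \<le> 0"
    by (rule LIMSEQ_le_const) (use bound in auto)
  then show ?thesis by simp
qed

text \<open>By the Dynkin argument only open intervals matter. Their indicators are limits of
  truncated multiples of the distance to the complement, each bounded by 1 and Lipschitz with
  constant \<open>n\<close>.\<close>

lemma integral_weak_derivative_on_vimage:
  fixes U g :: "'a::euclidean_space \<Rightarrow> real"
  assumes U: "integrable lborel U" and g: "integrable lborel g"
    and weak: "weak_directional_derivative v U g" and A: "A \<in> sets borel"
  shows "(LINT x|lborel. indicator A (U x) * g x) = 0"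
proof (rule integral_vimage_borel_eq_0[OF g _ _ A])
  show [measurable]: "U \<in> borel_measurable lborel" using U by simp
  fix a b :: real
  let ?C = "- box a b"
  \<comment> \<open>By convention \<open>infdist\<close> to the empty set is 0; the endpoint
    \<open>a\<close> always lies in the complement.\<close>
  have C: "closed ?C" "?C \<noteq> {}" by (auto simp: closed_Compl intro!: exI[of _ a])
  define k where "k n t = min 1 (real n * infdist t ?C)" for n t
  have kL: "\<bar>k n s - k n t\<bar> \<le> real n * \<bar>s - t\<bar>" for n s t
  proof -
    have "\<bar>k n s - k n t\<bar> \<le> \<bar>real n * infdist s ?C - real n * infdist t ?C\<bar>"
      by (auto simp: k_def min_def)
    also have "\<dots> = real n * \<bar>infdist s ?C - infdist t ?C\<bar>"
      by (simp add: abs_mult right_diff_distrib[symmetric])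
    also have "\<dots> \<le> real n * \<bar>s - t\<bar>"
      using infdist_triangle_abs[of s ?C t] by (intro mult_left_mono) (auto simp: dist_real_def)
    finally show ?thesis .
  qed
  have k1: "\<bar>k n t\<bar> \<le> 1" for n t by (simp add: k_def infdist_nonneg)
  have k_lim: "(\<lambda>n. k n t) \<longlonglongrightarrow> indicator (box a b) t" for t
  proof (cases "t \<in> box a b")
    case True
    then have p: "infdist t ?C > 0" by (intro infdist_pos_not_in_closed C) auto
    obtain N :: nat where N: "1 < real N * infdist t ?C" using reals_Archimedean3[OF p] by blast
    have "k n t = 1" if "n \<ge> N" for n
    proof -
      have "real N * infdist t ?C \<le> real n * infdist t ?C" using that p by (intro mult_right_mono) auto
      then show ?thesis using N by (simp add: k_def)
    qed
    then show ?thesis using True by (intro tendsto_eventually eventually_sequentiallyI[of N]) simp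
  next
    case False
    then show ?thesis using infdist_zero[of t ?C] by (simp add: k_def)
  qed
  have [measurable]: "k n \<in> borel_measurable borel" for n
    unfolding k_def by (intro borel_measurable_continuous_onI continuous_intros)
  have "(\<lambda>n. LINT x|lborel. k n (U x) * g x) \<longlonglongrightarrow> (LINT x|lborel. indicator (box a b) (U x) * g x)"
  proof (rule integral_dominated_convergence[where w="\<lambda>x. \<bar>g x\<bar>"])
    show "AE x in lborel. norm (k n (U x) * g x) \<le> \<bar>g x\<bar>" for n
      using k1 by (intro AE_I2) (simp add: abs_mult mult_left_le_one_le)
  qed (use g k_lim in \<open>auto intro!: AE_I2 tendsto_mult\<close>)
  then show "(LINT x|lborel. indicator (box a b) (U x) * g x) = 0"
    by (simp add: integral_chain_rule_eq_0[OF U g weak k1 kL] LIMSEQ_const_iff)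
qed

subsection \<open>Weak gradients\<close>

lemma integrable_lborel_compact_support:
  fixes f :: "'a::euclidean_space \<Rightarrow> real"
  assumes "compact C" "continuous_on UNIV f" "\<And>x. x \<notin> C \<Longrightarrow> f x = 0"
  shows "integrable lborel f"
proof -
  have "integrable lborel (\<lambda>x. indicator C x *\<^sub>R f x)"
    by (rule borel_integrable_compact[OF assms(1) continuous_on_subset[OF assms(2)]]) simp
  moreover have "(\<lambda>x. indicator C x *\<^sub>R f x) = f"
    using assms(3) by (auto simp: fun_eq_iff indicator_def)
  ultimately show ?thesis by simp
qed

text \<open>Translation by \<open>v\<close> preserves the integral of \<open>\<psi>\<close>; the
  integral of the difference, rewritten along segments and by Fubini, is the integral of the
  derivative.\<close>

lemma integral_C1c_gradient_eq_0:
  assumes \<psi>: "\<psi> \<in> C1c UNIV" and D: "C1_gradient \<psi> D"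
  shows "integrable lborel (\<lambda>x. D x \<bullet> v)" "(LINT x|lborel. D x \<bullet> v) = 0"
proof -
  let ?C = "closure {x. \<psi> x \<noteq> 0}"
  have C: "compact ?C" using \<psi> by (simp add: C1c_iff)
  note int = integrable_lborel_compact_support[OF C]
  have "D x \<bullet> v = 0" if "x \<notin> ?C" for x
    using C1_gradient_zero_outside[OF D that] by (simp only: inner_zero_left)
  moreover have "continuous_on UNIV (\<lambda>x. D x \<bullet> v)"
    using D by (auto simp: C1_gradient_def intro!: continuous_intros)
  ultimately show Dv: "integrable lborel (\<lambda>x. D x \<bullet> v)" by (rule int[rotated])
  have \<psi>i: "integrable lborel \<psi>"
  proof (rule int)
    show "\<psi> x = 0" if "x \<notin> ?C" for x using that closure_subset[of "{x. \<psi> x \<noteq> 0}"] by blast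
  qed (rule C1c_continuous[OF \<psi>])
  have [measurable]: "(\<lambda>x. D x \<bullet> v) \<in> borel_measurable borel" using Dv by simp
  have "0 = (LINT x|lborel. \<psi> (x + v)) - (LINT x|lborel. \<psi> x)"
    using integral_lborel_translate[of \<psi> v] \<psi>i by simp
  also have "\<dots> = (LINT x|lborel. LINT t|lborel. indicator {0..1::real} t * (D (x + t *\<^sub>R v) \<bullet> v))"
    using \<psi>i integrable_lborel_translate[OF \<psi>i] by (simp add: C1_gradient_FTC[OF D])
  also have "\<dots> = (LINT t|lborel. LINT x|lborel. indicator {0..1::real} t * (D (x + t *\<^sub>R v) \<bullet> v))"
    by (rule lborel_pair.Fubini_integral[OF integrable_shear[OF Dv]])
  also have "\<dots> = (LINT t|lborel. indicator {0..1::real} t * (LINT x|lborel. D x \<bullet> v))"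
    using integral_lborel_translate[of "\<lambda>x. D x \<bullet> v"] by simp
  also have "\<dots> = (LINT x|lborel. D x \<bullet> v)" by simp
  finally show "(LINT x|lborel. D x \<bullet> v) = 0" ..
qed

lemma integral_lebesgue_on_eq_lborel:
  fixes f :: "'a::euclidean_space \<Rightarrow> real"
  assumes "\<Omega> \<in> sets lebesgue" "f \<in> borel_measurable borel" "\<And>x. x \<notin> \<Omega> \<Longrightarrow> f x = 0"
  shows "(LINT x|lebesgue_on \<Omega>. f x) = (LINT x|lborel. f x)"
proof -
  have "(\<lambda>x. indicator \<Omega> x *\<^sub>R f x) = f" using assms(3) by (auto simp: fun_eq_iff indicator_def)
  then have "(LINT x|lebesgue_on \<Omega>. f x) = (LINT x|lebesgue. f x)"
    using assms(1) by (subst integral_restrict_space) auto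
  then show ?thesis using assms(2) by (simp add: integral_completion)
qed

text \<open>The product of the two functions has compact support even though \<open>\<Psi>\<close>
  need not, so its gradient integrates to 0. Thus \<open>\<Psi>\<close> is unrestricted at the
  boundary of \<Omega>.\<close>

lemma integral_by_parts_C1c:
  fixes \<Omega> :: "'a::euclidean_space set"
  assumes \<Omega>: "\<Omega> \<in> sets lebesgue" and \<psi>: "\<psi> \<in> C1c \<Omega>" "C1_gradient \<psi> D"
    and \<Psi>: "C1_gradient \<Psi> E"
  shows "(LINT x|lebesgue_on \<Omega>. \<psi> x * (E x \<bullet> v)) = - (LINT x|lebesgue_on \<Omega>. (D x \<bullet> v) * \<Psi> x)"
proof -
  have c: "continuous_on UNIV \<psi>" "continuous_on UNIV \<Psi>" "continuous_on UNIV D" "continuous_on UNIV E"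
    using assms C1_gradient_continuous by (auto simp: C1_gradient_def)
  have z: "\<psi> x = 0" "D x = 0" if "x \<notin> \<Omega>" for x
    using that C1_gradient_zero_outside[OF \<psi>(2)] \<psi>(1) closure_subset[of "{x. \<psi> x \<noteq> 0}"] by (auto simp: C1c_iff)
  have U: "\<psi> \<in> C1c UNIV" using \<psi>(1) C1c_subset[of \<Omega> UNIV] by auto
  have "compact (closure {x. \<psi> x \<noteq> 0})" using \<psi>(1) by (simp add: C1c_iff)
  note mono = integrable_lborel_compact_support[OF this]
  have i1: "integrable lborel (\<lambda>x. \<psi> x * (E x \<bullet> v))"
  proof (rule mono)
    show "\<psi> x * (E x \<bullet> v) = 0" if "x \<notin> closure {x. \<psi> x \<noteq> 0}" for x
    proof -
      have "\<psi> x = 0" using that closure_subset[of "{x. \<psi> x \<noteq> 0}"] by blast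
      then show ?thesis by (simp only: mult_zero_left)
    qed
  qed (use c in \<open>auto intro!: continuous_intros\<close>)
  have i2: "integrable lborel (\<lambda>x. (D x \<bullet> v) * \<Psi> x)"
  proof (rule mono)
    show "(D x \<bullet> v) * \<Psi> x = 0" if "x \<notin> closure {x. \<psi> x \<noteq> 0}" for x
      using C1_gradient_zero_outside[OF \<psi>(2) that] by (simp only: inner_zero_left mult_zero_left)
  qed (use c in \<open>auto intro!: continuous_intros\<close>)
  have "(LINT x|lborel. (\<Psi> x *\<^sub>R D x + \<psi> x *\<^sub>R E x) \<bullet> v) = 0"
    by (rule integral_C1c_gradient_eq_0(2)[OF C1c_mult[OF \<Psi> U] C1_gradient_mult[OF \<Psi> \<psi>(2)]])
  then have "(LINT x|lborel. \<psi> x * (E x \<bullet> v)) = - (LINT x|lborel. (D x \<bullet> v) * \<Psi> x)"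
    using i1 i2 by (simp add: inner_add_left mult.commute)
  moreover have "(LINT x|lebesgue_on \<Omega>. \<psi> x * (E x \<bullet> v)) = (LINT x|lborel. \<psi> x * (E x \<bullet> v))"
    using i1 z by (intro integral_lebesgue_on_eq_lborel \<Omega>) auto
  moreover have "(LINT x|lebesgue_on \<Omega>. (D x \<bullet> v) * \<Psi> x) = (LINT x|lborel. (D x \<bullet> v) * \<Psi> x)"
    using i2 z by (intro integral_lebesgue_on_eq_lborel \<Omega>) auto
  ultimately show ?thesis by simp
qed

section \<open>Locally integrable functions paired with test functions\<close>

lemma integrable_L1_loc_mult:
  fixes f :: "'a::euclidean_space \<Rightarrow> real"
  assumes f: "f \<in> L1_loc \<Omega>" and \<Omega>: "\<Omega> \<in> sets lebesgue"
    and C: "compact C" "C \<subseteq> \<Omega>"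
    and b: "continuous_on UNIV b" "\<And>x. \<bar>b x\<bar> \<le> B" "\<And>x. x \<notin> C \<Longrightarrow> b x = 0"
  shows "integrable (lebesgue_on \<Omega>) (\<lambda>x. f x * b x)"
proof -
  have [simp]: "C \<in> sets lebesgue" using C by (simp add: borel_compact)
  have "integrable (lebesgue_on C) f" using f C by (simp add: L1_loc_def)
  then have fi: "integrable lebesgue (\<lambda>x. indicator C x * f x)" by (simp add: integrable_restrict_space)
  have "b \<in> borel_measurable lebesgue"
    using borel_measurable_continuous_onI[OF b(1)] by (simp add: measurable_completion)
  then have "integrable lebesgue (\<lambda>x. (indicator C x * f x) * b x)"
    using b(2) order_trans[OF abs_ge_zero b(2)] fi
    by (intro Bochner_Integration.integrable_bound[where g="\<lambda>x. (indicator C x * f x) * b x" and f="\<lambda>x. B * (indicator C x * f x)"]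
        borel_measurable_times[OF borel_measurable_integrable[OF fi]])
      (auto simp: abs_mult mult.commute[of B] intro!: mult_left_mono)
  moreover have "(\<lambda>x. (indicator C x * f x) * b x) = (\<lambda>x. indicator \<Omega> x *\<^sub>R (f x * b x))"
    using b(3) C(2) by (auto simp: fun_eq_iff indicator_def)
  ultimately show ?thesis using \<Omega> by (simp add: integrable_restrict_space)
qed

lemma L1_loc_inner: "g \<in> L1_loc \<Omega> \<Longrightarrow> (\<lambda>x. g x \<bullet> i) \<in> L1_loc \<Omega>"
  by (auto simp: L1_loc_def)

lemma L1_loc_add: "f \<in> L1_loc \<Omega> \<Longrightarrow> g \<in> L1_loc \<Omega> \<Longrightarrow> (\<lambda>x. f x + g x) \<in> L1_loc \<Omega>"
  by (auto simp: L1_loc_def)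

lemma L1_loc_diff: "f \<in> L1_loc \<Omega> \<Longrightarrow> g \<in> L1_loc \<Omega> \<Longrightarrow> (\<lambda>x. f x - g x) \<in> L1_loc \<Omega>"
  by (auto simp: L1_loc_def)

lemma L1_loc_continuous: "continuous_on UNIV f \<Longrightarrow> f \<in> L1_loc \<Omega>"
proof -
  assume f: "continuous_on UNIV f"
  have "integrable (lebesgue_on C) f" if C: "compact C" for C
  proof -
    have "integrable lborel (\<lambda>x. indicator C x *\<^sub>R f x)"
      by (rule borel_integrable_compact[OF C continuous_on_subset[OF f]]) simp
    then have "integrable lebesgue (\<lambda>x. indicator C x *\<^sub>R f x)"
      by (subst integrable_completion) auto
    then show ?thesis using C by (simp add: integrable_restrict_space borel_compact)
  qed
  then show ?thesis by (simp add: L1_loc_def)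
qed

lemma integrable_L1_loc_mult_C1c:
  fixes f :: "'a::euclidean_space \<Rightarrow> real"
  assumes f: "f \<in> L1_loc \<Omega>" and \<Omega>: "\<Omega> \<in> sets lebesgue" and \<psi>: "\<psi> \<in> C1c \<Omega>" "C1_gradient \<psi> D"
  shows "integrable (lebesgue_on \<Omega>) (\<lambda>x. f x * \<psi> x)"
    and "integrable (lebesgue_on \<Omega>) (\<lambda>x. f x * (D x \<bullet> v))"
proof -
  define C where "C = closure {x. \<psi> x \<noteq> 0}"
  have C: "compact C" "C \<subseteq> \<Omega>" using \<psi>(1) by (auto simp: C_def C1c_iff)
  obtain B where B: "0 \<le> B" "\<And>x. \<bar>\<psi> x\<bar> \<le> B" "\<And>x. norm (D x) \<le> B"
    using C1c_boundedE[OF \<psi>] by metis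
  show "integrable (lebesgue_on \<Omega>) (\<lambda>x. f x * \<psi> x)"
  proof (rule integrable_L1_loc_mult[OF f \<Omega> C C1c_continuous[OF \<psi>(1)] B(2)])
    show "\<psi> x = 0" if "x \<notin> C" for x
      using that closure_subset[of "{x. \<psi> x \<noteq> 0}"] unfolding C_def by blast
  qed
  show "integrable (lebesgue_on \<Omega>) (\<lambda>x. f x * (D x \<bullet> v))"
  proof (rule integrable_L1_loc_mult[OF f \<Omega> C])
    show "continuous_on UNIV (\<lambda>x. D x \<bullet> v)"
      using \<psi>(2) by (auto simp: C1_gradient_def intro!: continuous_intros)
    show "\<bar>D x \<bullet> v\<bar> \<le> B * norm v" for x
      using Cauchy_Schwarz_ineq2 B(3) by (meson mult_right_mono norm_ge_zero order_trans)
    show "D x \<bullet> v = 0" if "x \<notin> C" for x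
      using C1_gradient_zero_outside[OF \<psi>(2)] that unfolding C_def by (metis inner_zero_left)
  qed
qed

section \<open>Calculus and uniqueness of weak gradients\<close>

lemma has_weak_gradient_iff:
  "has_weak_gradient \<Omega> u g \<longleftrightarrow> u \<in> L1_loc \<Omega> \<and> g \<in> L1_loc \<Omega> \<and>
     (\<forall>\<psi>\<in>C1c \<Omega>. \<forall>D. C1_gradient \<psi> D \<longrightarrow> (\<forall>i\<in>Basis.
        (LINT x|lebesgue_on \<Omega>. u x * (D x \<bullet> i)) = - (LINT x|lebesgue_on \<Omega>. (g x \<bullet> i) * \<psi> x)))"
proof -
  have "(\<forall>i\<in>Basis. (LINT x|lebesgue_on \<Omega>. u x * frechet_derivative \<psi> (at x) i)
          = - (LINT x|lebesgue_on \<Omega>. (g x \<bullet> i) * \<psi> x)) \<longleftrightarrow>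
      (\<forall>D. C1_gradient \<psi> D \<longrightarrow> (\<forall>i\<in>Basis.
        (LINT x|lebesgue_on \<Omega>. u x * (D x \<bullet> i)) = - (LINT x|lebesgue_on \<Omega>. (g x \<bullet> i) * \<psi> x)))"
    (is "?L \<longleftrightarrow> ?R") if \<psi>: "\<psi> \<in> C1c \<Omega>" for \<psi>
  proof
    assume L: ?L
    show ?R
    proof (intro allI impI)
      fix D assume "C1_gradient \<psi> D"
      from L[unfolded C1_gradient_frechet[OF this]] show "\<forall>i\<in>Basis.
        (LINT x|lebesgue_on \<Omega>. u x * (D x \<bullet> i)) = - (LINT x|lebesgue_on \<Omega>. (g x \<bullet> i) * \<psi> x)" .
    qed
  next
    assume R: ?R
    obtain D where D: "C1_gradient \<psi> D" using \<psi> by (auto simp: C1c_iff)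
    then show ?L unfolding C1_gradient_frechet[OF D] using R by blast
  qed
  then show ?thesis unfolding has_weak_gradient_def by (intro conj_cong ball_cong refl)
qed

lemma has_weak_gradientD:
  "has_weak_gradient \<Omega> u g \<Longrightarrow> \<psi> \<in> C1c \<Omega> \<Longrightarrow> C1_gradient \<psi> D \<Longrightarrow> i \<in> Basis \<Longrightarrow>
    (LINT x|lebesgue_on \<Omega>. u x * (D x \<bullet> i)) = - (LINT x|lebesgue_on \<Omega>. (g x \<bullet> i) * \<psi> x)"
  unfolding has_weak_gradient_iff by blast

lemma has_weak_gradient_add:
  assumes \<Omega>: "open \<Omega>" and u: "has_weak_gradient \<Omega> u g" and v: "has_weak_gradient \<Omega> v h"
  shows "has_weak_gradient \<Omega> (\<lambda>x. u x + v x) (\<lambda>x. g x + h x)"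
proof -
  have \<Omega>': "\<Omega> \<in> sets lebesgue" using \<Omega> by auto
  have L: "u \<in> L1_loc \<Omega>" "v \<in> L1_loc \<Omega>" "g \<in> L1_loc \<Omega>" "h \<in> L1_loc \<Omega>"
    using u v by (auto simp: has_weak_gradient_def)
  note ints = L(1,2)[THEN integrable_L1_loc_mult_C1c(2)[OF _ \<Omega>']] L(3,4)[THEN L1_loc_inner, THEN integrable_L1_loc_mult_C1c(1)[OF _ \<Omega>']]
  show ?thesis
    using u v L ints unfolding has_weak_gradient_iff
    by (simp add: L1_loc_add distrib_right inner_add_left)
qed

lemma has_weak_gradient_diff:
  assumes \<Omega>: "open \<Omega>" and u: "has_weak_gradient \<Omega> u g" and v: "has_weak_gradient \<Omega> v h"
  shows "has_weak_gradient \<Omega> (\<lambda>x. u x - v x) (\<lambda>x. g x - h x)"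
proof -
  have \<Omega>': "\<Omega> \<in> sets lebesgue" using \<Omega> by auto
  have L: "u \<in> L1_loc \<Omega>" "v \<in> L1_loc \<Omega>" "g \<in> L1_loc \<Omega>" "h \<in> L1_loc \<Omega>"
    using u v by (auto simp: has_weak_gradient_def)
  note ints = L(1,2)[THEN integrable_L1_loc_mult_C1c(2)[OF _ \<Omega>']] L(3,4)[THEN L1_loc_inner, THEN integrable_L1_loc_mult_C1c(1)[OF _ \<Omega>']]
  show ?thesis
    using u v L ints unfolding has_weak_gradient_iff
    by (simp add: L1_loc_diff left_diff_distrib inner_diff_left)
qed

lemma has_weak_gradient_C1c:
  assumes "open \<Omega>" "\<psi> \<in> C1c \<Omega>" "C1_gradient \<psi> D"
  shows "has_weak_gradient \<Omega> \<psi> D"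
  using assms integral_by_parts_C1c[OF _ assms(2,3)] C1_gradient_continuous[OF assms(3)]
  by (auto simp: has_weak_gradient_iff L1_loc_continuous C1_gradient_def)

lemma has_weak_gradient_subset:
  assumes u: "has_weak_gradient UNIV u g" and \<Omega>: "open \<Omega>"
  shows "has_weak_gradient \<Omega> u g"
  unfolding has_weak_gradient_iff
proof (intro conjI ballI allI impI)
  show "u \<in> L1_loc \<Omega>" "g \<in> L1_loc \<Omega>" using u by (auto simp: has_weak_gradient_def L1_loc_def)
  fix \<psi> D and i :: 'a assume \<psi>: "\<psi> \<in> C1c \<Omega>" "C1_gradient \<psi> D" and i: "i \<in> Basis"
  have "\<psi> \<in> C1c UNIV" using \<psi>(1) C1c_subset[of \<Omega> UNIV] by auto
  then have eq: "(LINT x|lebesgue_on UNIV. u x * (D x \<bullet> i)) = - (LINT x|lebesgue_on UNIV. (g x \<bullet> i) * \<psi> x)"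
    using u \<psi>(2) i by (auto simp: has_weak_gradient_iff)
  have z: "\<psi> x = 0" "D x = 0" if "x \<notin> \<Omega>" for x
    using that C1_gradient_zero_outside[OF \<psi>(2)] \<psi>(1) closure_subset[of "{x. \<psi> x \<noteq> 0}"] by (auto simp: C1c_iff)
  have "(LINT x|lebesgue_on \<Omega>. f x) = (LINT x|lebesgue_on UNIV. f x)" if "\<And>x. x \<notin> \<Omega> \<Longrightarrow> f x = 0" for f :: "'a \<Rightarrow> real"
    using that \<Omega> by (subst (1 2) integral_restrict_space) (auto intro!: Bochner_Integration.integral_cong simp: indicator_def)
  from this[of "\<lambda>x. u x * (D x \<bullet> i)"] this[of "\<lambda>x. (g x \<bullet> i) * \<psi> x"] eq z
  show "(LINT x|lebesgue_on \<Omega>. u x * (D x \<bullet> i)) = - (LINT x|lebesgue_on \<Omega>. (g x \<bullet> i) * \<psi> x)"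
    by simp
qed

lemma has_weak_gradient_unique:
  fixes g h :: "'a::euclidean_space \<Rightarrow> 'a"
  assumes \<Omega>: "open \<Omega>" and u: "has_weak_gradient \<Omega> u g" "has_weak_gradient \<Omega> u h"
  shows "AE x in lebesgue_on \<Omega>. g x = h x"
proof -
  have \<Omega>': "\<Omega> \<in> sets lebesgue" using \<Omega> by auto
  have L: "g \<in> L1_loc \<Omega>" "h \<in> L1_loc \<Omega>" using u by (auto simp: has_weak_gradient_def)
  have "AE x in lebesgue_on \<Omega>. (g x - h x) \<bullet> i = 0" if i: "i \<in> Basis" for i
  proof (rule AE_eq_0_if_weakly_0[OF \<Omega>])
    show "(\<lambda>x. (g x - h x) \<bullet> i) \<in> L1_loc \<Omega>" using L by (intro L1_loc_inner L1_loc_diff)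
    fix \<psi> assume \<psi>: "\<psi> \<in> C1c \<Omega>"
    then obtain D where D: "C1_gradient \<psi> D" by (auto simp: C1c_iff)
    have "(LINT x|lebesgue_on \<Omega>. (g x \<bullet> i) * \<psi> x) = (LINT x|lebesgue_on \<Omega>. (h x \<bullet> i) * \<psi> x)"
      using u[THEN has_weak_gradientD, OF \<psi> D i] by simp
    then show "(LINT x|lebesgue_on \<Omega>. ((g x - h x) \<bullet> i) * \<psi> x) = 0"
      using L[THEN L1_loc_inner, THEN integrable_L1_loc_mult_C1c(1)[OF _ \<Omega>' \<psi> D]]
      by (simp add: inner_diff_left left_diff_distrib)
  qed
  then have "AE x in lebesgue_on \<Omega>. \<forall>i\<in>Basis. (g x - h x) \<bullet> i = 0"
    by (simp add: AE_finite_all)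
  then show ?thesis
    by eventually_elim (auto intro: euclidean_eqI simp: inner_diff_left)
qed

text \<open>\<open>weak_gradient\<close> is an arbitrary choice; uniqueness almost everywhere
  transfers properties of a concrete gradient to it.\<close>

lemma weak_gradient_AE_eq:
  assumes "open \<Omega>" "has_weak_gradient \<Omega> u g"
  shows "AE x in lebesgue_on \<Omega>. weak_gradient \<Omega> u x = g x"
proof -
  have "has_weak_gradient \<Omega> u (weak_gradient \<Omega> u)"
    unfolding weak_gradient_def using assms(2) by (rule someI[of "has_weak_gradient \<Omega> u"])
  from has_weak_gradient_unique[OF assms(1) this assms(2)] show ?thesis .
qed

subsection \<open>Zero boundary values\<close>

lemma Lp_space_diff:
  assumes f: "f \<in> Lp_space \<Omega> p" and g: "g \<in> Lp_space \<Omega> p" and p: "0 \<le> p"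
  shows "(\<lambda>x. f x - g x) \<in> Lp_space \<Omega> p"
proof -
  have fm: "f \<in> borel_measurable (lebesgue_on \<Omega>)" and gm: "g \<in> borel_measurable (lebesgue_on \<Omega>)"
    using f g by (auto simp: Lp_space_def)
  have le: "norm (f x - g x) powr p \<le> 2 powr p * (norm (f x) powr p + norm (g x) powr p)" for x
  proof -
    have "norm (f x - g x) \<le> 2 * max (norm (f x)) (norm (g x))"
      using norm_triangle_ineq4[of "f x" "g x"] by linarith
    then have "norm (f x - g x) powr p \<le> (2 * max (norm (f x)) (norm (g x))) powr p"
      using p by (intro powr_mono2) auto
    also have "\<dots> = 2 powr p * max (norm (f x)) (norm (g x)) powr p" by (simp add: powr_mult)
    also have "max (norm (f x)) (norm (g x)) powr p \<le> norm (f x) powr p + norm (g x) powr p"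
      by (simp add: max_def)
    finally show ?thesis by simp
  qed
  have "integrable (lebesgue_on \<Omega>) (\<lambda>x. norm (f x - g x) powr p)"
  proof (rule Bochner_Integration.integrable_bound)
    show "integrable (lebesgue_on \<Omega>) (\<lambda>x. 2 powr p * (norm (f x) powr p + norm (g x) powr p))"
      using f g by (simp add: Lp_space_def)
    show "(\<lambda>x. norm (f x - g x) powr p) \<in> borel_measurable (lebesgue_on \<Omega>)"
      using fm gm by measurable
    show "AE x in lebesgue_on \<Omega>. norm (norm (f x - g x) powr p) \<le> norm (2 powr p * (norm (f x) powr p + norm (g x) powr p))"
      using le by (intro AE_I2) simp
  qed
  then show ?thesis using fm gm by (simp add: Lp_space_def)
qed

text \<open>Where \<open>norm (w x) > \<delta>\<close>, one has \<open>norm (w x) \<le> \<delta> powr (1 - p) * norm (w x) powr p\<close>.\<close>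

lemma Lp_space_L1_bound:
  assumes \<Omega>: "\<Omega> \<in> lmeasurable" and p: "1 \<le> p" and w: "w \<in> Lp_space \<Omega> p" and \<delta>: "\<delta> > 0"
  shows "integrable (lebesgue_on \<Omega>) w"
    and "(LINT x|lebesgue_on \<Omega>. norm (w x)) \<le>
      \<delta> * measure lebesgue \<Omega> + \<delta> powr (1 - p) * (LINT x|lebesgue_on \<Omega>. norm (w x) powr p)"
proof -
  interpret finite_measure "lebesgue_on \<Omega>" using \<Omega> by (rule finite_measure_lebesgue_on)
  have wm: "w \<in> borel_measurable (lebesgue_on \<Omega>)" and wp: "integrable (lebesgue_on \<Omega>) (\<lambda>x. norm (w x) powr p)"
    using w by (auto simp: Lp_space_def)
  have le: "norm (w x) \<le> \<delta> + \<delta> powr (1 - p) * norm (w x) powr p" for x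
  proof (cases "norm (w x) \<le> \<delta>")
    case False
    then have n: "norm (w x) > 0" using \<delta> by linarith
    have "norm (w x) = norm (w x) powr (1 - p) * norm (w x) powr p"
      using n by (simp add: powr_add[symmetric])
    also have "\<dots> \<le> \<delta> powr (1 - p) * norm (w x) powr p"
      using p False \<delta> by (intro mult_right_mono powr_mono2') auto
    finally show ?thesis using \<delta> by simp
  qed (simp add: add_increasing2)
  have int: "integrable (lebesgue_on \<Omega>) (\<lambda>x. \<delta> + \<delta> powr (1 - p) * norm (w x) powr p)"
    using wp by simp
  have "AE x in lebesgue_on \<Omega>. norm (w x) \<le> norm (\<delta> + \<delta> powr (1 - p) * norm (w x) powr p)"
    using le by (intro AE_I2) (auto intro: order_trans[OF _ abs_ge_self])
  then show wi: "integrable (lebesgue_on \<Omega>) w"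
    by (rule Bochner_Integration.integrable_bound[OF int wm])
  have "(LINT x|lebesgue_on \<Omega>. norm (w x)) \<le> (LINT x|lebesgue_on \<Omega>. \<delta> + \<delta> powr (1 - p) * norm (w x) powr p)"
    using wi int le by (intro integral_mono) auto
  also have "\<dots> = \<delta> * measure lebesgue \<Omega> + \<delta> powr (1 - p) * (LINT x|lebesgue_on \<Omega>. norm (w x) powr p)"
    using wp \<Omega> by (simp add: measure_restrict_space fmeasurableD)
  finally show "(LINT x|lebesgue_on \<Omega>. norm (w x)) \<le>
      \<delta> * measure lebesgue \<Omega> + \<delta> powr (1 - p) * (LINT x|lebesgue_on \<Omega>. norm (w x) powr p)" .
qed

lemma Lp_space_bounded_continuous:
  assumes \<Omega>: "\<Omega> \<in> lmeasurable" and f: "continuous_on UNIV f" "\<And>x. norm (f x) \<le> B" and p: "0 \<le> p"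
  shows "f \<in> Lp_space \<Omega> p"
proof -
  interpret finite_measure "lebesgue_on \<Omega>" using \<Omega> by (rule finite_measure_lebesgue_on)
  have [measurable]: "f \<in> borel_measurable (lebesgue_on \<Omega>)"
    using \<Omega> continuous_on_subset[OF f(1)] by (intro continuous_imp_measurable_on_sets_lebesgue) auto
  have "integrable (lebesgue_on \<Omega>) (\<lambda>x. norm (f x) powr p)"
    using f(2) p by (intro integrable_const_bound[where B="B powr p"]) (auto intro!: powr_mono2)
  then show ?thesis by (simp add: Lp_space_def)
qed

text \<open>Completeness of Lebesgue measure. It gives measurability of the norm term built from the
  gradient chosen by \<open>weak_gradient\<close>.\<close>

lemma borel_measurable_lebesgue_on_AE:
  fixes f g :: "'a::euclidean_space \<Rightarrow> 'b::euclidean_space"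
  assumes \<Omega>: "\<Omega> \<in> sets lebesgue" and f: "f \<in> borel_measurable (lebesgue_on \<Omega>)"
    and eq: "AE x in lebesgue_on \<Omega>. f x = g x"
  shows "g \<in> borel_measurable (lebesgue_on \<Omega>)"
proof -
  have "(\<lambda>x. indicator \<Omega> x *\<^sub>R f x) \<in> borel_measurable lebesgue"
    using \<Omega> f by (simp add: borel_measurable_restrict_space_iff)
  moreover have "AE x in lebesgue. indicator \<Omega> x *\<^sub>R f x = indicator \<Omega> x *\<^sub>R g x"
    using eq \<Omega> by (auto simp: AE_restrict_space_iff elim!: eventually_mono)
  ultimately have "(\<lambda>x. indicator \<Omega> x *\<^sub>R g x) \<in> borel_measurable lebesgue"
    by (rule borel_measurable_AE)
  then show ?thesis using \<Omega> by (simp add: borel_measurable_restrict_space_iff)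
qed

text \<open>\<open>W1p_norm\<close> sees the gradient of the difference through the chosen
  representative, which is replaced by \<open>g - D\<close> for the given \<open>g\<close>. Finite
  measure then turns small p-th powers into small L^1 norms.\<close>

lemma W1p_0_L1_approx:
  assumes \<Omega>: "open \<Omega>" "bounded \<Omega>" and p: "1 \<le> p"
    and v: "v \<in> W1p_0 \<Omega> p" and g: "g \<in> Lp_space \<Omega> p" "has_weak_gradient \<Omega> v g" and e: "e > 0"
  obtains \<psi> D where "\<psi> \<in> C1c \<Omega>" "C1_gradient \<psi> D"
    "integrable (lebesgue_on \<Omega>) (\<lambda>x. v x - \<psi> x)" "(LINT x|lebesgue_on \<Omega>. \<bar>v x - \<psi> x\<bar>) \<le> e"
    "integrable (lebesgue_on \<Omega>) (\<lambda>x. g x - D x)" "(LINT x|lebesgue_on \<Omega>. norm (g x - D x)) \<le> e"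
proof -
  have \<Omega>': "\<Omega> \<in> lmeasurable" using \<Omega> by (simp add: lmeasurable_open)
  define \<mu> where "\<mu> = measure lebesgue \<Omega>"
  have \<mu>: "\<mu> \<ge> 0" by (simp add: \<mu>_def)
  \<comment> \<open>With the p-th powers bounded by \<open>\<delta> powr p\<close>, the L^1 estimate
    at level \<open>\<delta>\<close> gives \<open>\<delta> * \<mu> + \<delta> = e\<close>. The
    summand 1 also keeps the divisor positive when \<Omega> is null.\<close>
  define \<delta> where "\<delta> = e / (\<mu> + 1)"
  have "\<delta> * (\<mu> + 1) = e" using \<mu> by (simp add: \<delta>_def)
  then have \<delta>: "\<delta> > 0" "\<delta> * \<mu> + \<delta> = e" using e \<mu> by (auto simp: \<delta>_def distrib_left)
  obtain \<psi> where \<psi>: "\<psi> \<in> C1c \<Omega>" and norm: "W1p_norm \<Omega> p (\<lambda>x. v x - \<psi> x) < \<delta>"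
    using v \<delta>(1) by (auto simp: W1p_0_def)
  obtain D where D: "C1_gradient \<psi> D" using \<psi> by (auto simp: C1c_iff)
  obtain B where B: "\<And>x. \<bar>\<psi> x\<bar> \<le> B" "\<And>x. norm (D x) \<le> B" using C1c_boundedE[OF \<psi> D] by metis
  have v': "v \<in> Lp_space \<Omega> p" using v by (simp add: W1p_0_def W1p_def)
  have w1: "(\<lambda>x. v x - \<psi> x) \<in> Lp_space \<Omega> p"
    using p B C1c_continuous[OF \<psi>] by (intro Lp_space_diff v' Lp_space_bounded_continuous[OF \<Omega>', of _ B]) auto
  have w2: "(\<lambda>x. g x - D x) \<in> Lp_space \<Omega> p"
    using p B D by (intro Lp_space_diff g Lp_space_bounded_continuous[OF \<Omega>', of _ B]) (auto simp: C1_gradient_def)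
  let ?I1 = "LINT x|lebesgue_on \<Omega>. norm (v x - \<psi> x) powr p"
  let ?I2 = "LINT x|lebesgue_on \<Omega>. norm (g x - D x) powr p"
  let ?I3 = "LINT x|lebesgue_on \<Omega>. norm (weak_gradient \<Omega> (\<lambda>x. v x - \<psi> x) x) powr p"
  have "AE x in lebesgue_on \<Omega>. weak_gradient \<Omega> (\<lambda>x. v x - \<psi> x) x = g x - D x"
    by (intro weak_gradient_AE_eq has_weak_gradient_diff has_weak_gradient_C1c \<Omega> g \<psi> D)
  then have eq: "AE x in lebesgue_on \<Omega>. norm (g x - D x) powr p = norm (weak_gradient \<Omega> (\<lambda>x. v x - \<psi> x) x) powr p"
    by eventually_elim simp
  have meas: "(\<lambda>x. norm (g x - D x) powr p) \<in> borel_measurable (lebesgue_on \<Omega>)"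
    using w2 by (auto simp: Lp_space_def)
  have "?I2 = ?I3"
    by (rule integral_cong_AE[OF meas borel_measurable_lebesgue_on_AE[OF fmeasurableD[OF \<Omega>'] meas eq] eq])
  then have "(?I1 + ?I2) powr (1 / p) < \<delta>" using norm by (simp add: W1p_norm_def)
  moreover have nn: "0 \<le> ?I1" "0 \<le> ?I2" by (auto intro!: integral_nonneg_AE)
  ultimately have "((?I1 + ?I2) powr (1 / p)) powr p \<le> \<delta> powr p"
    using p by (intro powr_mono2) auto
  then have sum: "?I1 + ?I2 \<le> \<delta> powr p"
    using p nn by (simp add: powr_powr)
  have I: "?I1 \<le> \<delta> powr p" "?I2 \<le> \<delta> powr p" using sum nn by linarith+
  have step: "\<delta> * \<mu> + \<delta> powr (1 - p) * I \<le> e" if "I \<le> \<delta> powr p" for I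
  proof -
    have "\<delta> powr (1 - p) * I \<le> \<delta> powr (1 - p) * \<delta> powr p" using that by (intro mult_left_mono) auto
    also have "\<dots> = \<delta>" using \<delta>(1) by (simp add: powr_add[symmetric])
    finally show ?thesis using \<delta>(2) by linarith
  qed
  show ?thesis
  proof (rule that[OF \<psi> D])
    show "integrable (lebesgue_on \<Omega>) (\<lambda>x. v x - \<psi> x)" "integrable (lebesgue_on \<Omega>) (\<lambda>x. g x - D x)"
      using Lp_space_L1_bound(1)[OF \<Omega>' p _ \<delta>(1)] w1 w2 by auto
    show "(LINT x|lebesgue_on \<Omega>. \<bar>v x - \<psi> x\<bar>) \<le> e"
      using Lp_space_L1_bound(2)[OF \<Omega>' p w1 \<delta>(1)] step[OF I(1)] by (simp add: \<mu>_def)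
    show "(LINT x|lebesgue_on \<Omega>. norm (g x - D x)) \<le> e"
      using Lp_space_L1_bound(2)[OF \<Omega>' p w2 \<delta>(1)] step[OF I(2)] by (simp add: \<mu>_def)
  qed
qed

lemma integrable_mult_bounded_continuous:
  fixes f b :: "'a::euclidean_space \<Rightarrow> real"
  assumes S: "S \<in> sets lebesgue" and f: "integrable (lebesgue_on S) f"
    and b: "continuous_on UNIV b" "\<And>x. \<bar>b x\<bar> \<le> B"
  shows "integrable (lebesgue_on S) (\<lambda>x. f x * b x)"
    and "\<bar>LINT x|lebesgue_on S. f x * b x\<bar> \<le> B * (LINT x|lebesgue_on S. \<bar>f x\<bar>)"
proof -
  have B: "B \<ge> 0" using b(2) order_trans[OF abs_ge_zero] by blast
  have bm: "b \<in> borel_measurable (lebesgue_on S)"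
    using S continuous_on_subset[OF b(1)] by (intro continuous_imp_measurable_on_sets_lebesgue) auto
  have le: "\<bar>f x * b x\<bar> \<le> B * \<bar>f x\<bar>" for x
    using mult_left_mono[OF b(2) abs_ge_zero[of "f x"]] by (simp add: abs_mult mult.commute)
  show int: "integrable (lebesgue_on S) (\<lambda>x. f x * b x)"
  proof (rule Bochner_Integration.integrable_bound)
    show "integrable (lebesgue_on S) (\<lambda>x. B * \<bar>f x\<bar>)" using f by simp
    show "AE x in lebesgue_on S. norm (f x * b x) \<le> norm (B * \<bar>f x\<bar>)"
      using le by (intro AE_I2) (metis abs_ge_self order_trans real_norm_def)
  qed (use f bm in simp)
  have "\<bar>LINT x|lebesgue_on S. f x * b x\<bar> \<le> (LINT x|lebesgue_on S. \<bar>f x * b x\<bar>)"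
    by (rule integral_abs_bound)
  also have "\<dots> \<le> (LINT x|lebesgue_on S. B * \<bar>f x\<bar>)"
    using int f le by (intro integral_mono) auto
  finally show "\<bar>LINT x|lebesgue_on S. f x * b x\<bar> \<le> B * (LINT x|lebesgue_on S. \<bar>f x\<bar>)" by simp
qed

text \<open>Unlike in the definition of the weak gradient, the test function need not vanish near the
  boundary of \<open>\<Omega>\<close>: the extension of \<open>v\<close> by zero is weakly differentiable on the whole space.\<close>

lemma W1p_0_by_parts:
  assumes \<Omega>: "open \<Omega>" "bounded \<Omega>" and p: "1 \<le> p"
    and v: "v \<in> W1p_0 \<Omega> p" and g: "g \<in> Lp_space \<Omega> p" "has_weak_gradient \<Omega> v g"
    and \<Psi>: "\<Psi> \<in> C1c UNIV" "C1_gradient \<Psi> E" and i: "i \<in> Basis"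
  shows "(LINT x|lebesgue_on \<Omega>. v x * (E x \<bullet> i)) = - (LINT x|lebesgue_on \<Omega>. (g x \<bullet> i) * \<Psi> x)"
proof -
  have \<Omega>': "\<Omega> \<in> lmeasurable" "\<Omega> \<in> sets lebesgue" using \<Omega> by (auto simp: lmeasurable_open)
  have vi: "integrable (lebesgue_on \<Omega>) v" and gi: "integrable (lebesgue_on \<Omega>) (\<lambda>x. g x \<bullet> i)"
    using v g Lp_space_L1_bound(1)[OF \<Omega>'(1) p, of _ 1] by (auto simp: W1p_0_def W1p_def)
  obtain B where B: "0 \<le> B" "\<And>x. \<bar>\<Psi> x\<bar> \<le> B" "\<And>x. norm (E x) \<le> B"
    using C1c_boundedE[OF \<Psi>] by metis
  have c: "continuous_on UNIV \<Psi>" "continuous_on UNIV (\<lambda>x. E x \<bullet> i)"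
    using C1c_continuous[OF \<Psi>(1)] \<Psi>(2) by (auto simp: C1_gradient_def intro!: continuous_intros)
  have Ei: "\<bar>E x \<bullet> i\<bar> \<le> B" for x using B(3)[of x] Basis_le_norm[OF i, of "E x"] by linarith
  note mi = integrable_mult_bounded_continuous[OF \<Omega>'(2) _ c(1) B(2)] integrable_mult_bounded_continuous[OF \<Omega>'(2) _ c(2) Ei]
  \<comment> \<open>The defect of the formula. It is unchanged when \<open>v\<close> and
    \<open>g\<close> are replaced by \<open>v - \<psi>\<close> and \<open>g - D\<close>, since the
    formula holds for \<open>\<psi>\<close>; hence it is arbitrarily small.\<close>
  define T where "T = (LINT x|lebesgue_on \<Omega>. v x * (E x \<bullet> i)) + (LINT x|lebesgue_on \<Omega>. (g x \<bullet> i) * \<Psi> x)"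
  have "\<bar>T\<bar> \<le> 2 * B * e" if e: "e > 0" for e
  proof -
    obtain \<psi> D where \<psi>: "\<psi> \<in> C1c \<Omega>" "C1_gradient \<psi> D"
      and a: "integrable (lebesgue_on \<Omega>) (\<lambda>x. v x - \<psi> x)" "(LINT x|lebesgue_on \<Omega>. \<bar>v x - \<psi> x\<bar>) \<le> e"
        "integrable (lebesgue_on \<Omega>) (\<lambda>x. g x - D x)" "(LINT x|lebesgue_on \<Omega>. norm (g x - D x)) \<le> e"
      by (rule W1p_0_L1_approx[OF \<Omega> p v g e])
    have ai: "integrable (lebesgue_on \<Omega>) (\<lambda>x. (g x - D x) \<bullet> i)" using a(3) by simp
    have "(LINT x|lebesgue_on \<Omega>. \<bar>(g x - D x) \<bullet> i\<bar>) \<le> (LINT x|lebesgue_on \<Omega>. norm (g x - D x))"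
      using a(3) ai Basis_le_norm[OF i] by (intro integral_mono integrable_abs integrable_norm) auto
    then have le: "(LINT x|lebesgue_on \<Omega>. \<bar>(g x - D x) \<bullet> i\<bar>) \<le> e" using a(4) by linarith
    have "(LINT x|lebesgue_on \<Omega>. (v x - \<psi> x) * (E x \<bullet> i)) + (LINT x|lebesgue_on \<Omega>. ((g x - D x) \<bullet> i) * \<Psi> x) = T"
    proof -
      have "\<psi> = (\<lambda>x. v x - (v x - \<psi> x))" "(\<lambda>x. D x \<bullet> i) = (\<lambda>x. g x \<bullet> i - (g x - D x) \<bullet> i)"
        by (auto simp: inner_diff_left)
      then have "integrable (lebesgue_on \<Omega>) \<psi>" "integrable (lebesgue_on \<Omega>) (\<lambda>x. D x \<bullet> i)"
        using Bochner_Integration.integrable_diff[OF vi a(1)] Bochner_Integration.integrable_diff[OF gi ai] by metis+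
      then show ?thesis
        using mi(3)[OF vi] mi(3)[of \<psi>] mi(1)[OF gi] mi(1)[of "\<lambda>x. D x \<bullet> i"] integral_by_parts_C1c[OF \<Omega>'(2) \<psi> \<Psi>(2), of i]
        by (simp add: T_def left_diff_distrib inner_diff_left)
    qed
    moreover have "\<bar>LINT x|lebesgue_on \<Omega>. (v x - \<psi> x) * (E x \<bullet> i)\<bar> \<le> B * e"
      using mi(4)[OF a(1)] mult_left_mono[OF a(2) B(1)] by linarith
    moreover have "\<bar>LINT x|lebesgue_on \<Omega>. ((g x - D x) \<bullet> i) * \<Psi> x\<bar> \<le> B * e"
      using mi(2)[OF ai] mult_left_mono[OF le B(1)] by linarith
    ultimately show ?thesis by linarith
  qed
  then have T: "\<bar>T\<bar> \<le> 2 * B * e" if "e > 0" for e using that by simp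
  have "\<bar>T\<bar> \<le> 0 + r" if r: "r > 0" for r
  proof -
    \<comment> \<open>The summand 1 avoids division by zero if \<open>B = 0\<close>.\<close>
    have "\<bar>T\<bar> \<le> 2 * B * (r / (2 * B + 1))" using r B(1) by (intro T) auto
    also have "\<dots> \<le> r" using r B(1) by (simp add: field_simps)
    finally show ?thesis by simp
  qed
  then have "\<bar>T\<bar> \<le> 0" by (rule field_le_epsilon)
  then show ?thesis by (simp add: T_def)
qed

text \<open>The translation and Fubini arguments live on \<open>lborel\<close>. Borel
  representatives of \<open>U\<close> and \<open>g\<close> carry the result over, as changes on null
  sets affect none of the integrals.\<close>

lemma integral_weak_derivative_on_vimage_lebesgue:
  fixes U g :: "'a::euclidean_space \<Rightarrow> real"
  assumes U: "integrable lebesgue U" and g: "integrable lebesgue g"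
    and weak: "\<And>\<psi> D. \<psi> \<in> C1c UNIV \<Longrightarrow> C1_gradient \<psi> D \<Longrightarrow>
      (LINT x|lebesgue. U x * (D x \<bullet> v)) = - (LINT x|lebesgue. g x * \<psi> x)"
    and A: "A \<in> sets borel"
  shows "(LINT x|lebesgue. indicator A (U x) * g x) = 0"
proof -
  have rep: "\<exists>f'. integrable lborel f' \<and> (AE x in lebesgue. f x = f' x)"
    if f: "integrable lebesgue f" for f :: "'a \<Rightarrow> real"
  proof -
    obtain f' where f': "f' \<in> borel_measurable lborel" "AE x in lborel. f x = f' x"
      using completion_ex_borel_measurable_real[of f lborel] f by auto
    then have ae: "AE x in lebesgue. f x = f' x" by (simp add: AE_completion)
    have "integrable lebesgue f'"
      by (rule integrable_cong_AE_imp[OF f measurable_completion[OF f'(1)]])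
        (use ae in \<open>auto elim: eventually_mono\<close>)
    then show ?thesis using f' ae by (auto simp: integrable_completion)
  qed
  obtain U' g' where U': "integrable lborel U'" "AE x in lebesgue. U x = U' x"
    and g': "integrable lborel g'" "AE x in lebesgue. g x = g' x" using rep[OF U] rep[OF g] by blast
  have [measurable]: "U' \<in> borel_measurable borel" "g' \<in> borel_measurable borel" using U' g' by auto
  have Um: "U \<in> borel_measurable lebesgue" and gm: "g \<in> borel_measurable lebesgue" using U g by auto
  have cm: "b \<in> borel_measurable borel \<Longrightarrow> b \<in> borel_measurable lebesgue" for b :: "'a \<Rightarrow> real"
    by (simp add: measurable_completion)
  have weak': "weak_directional_derivative v U' g'"
    unfolding weak_directional_derivative_def
  proof (intro ballI allI impI)
    fix \<psi> :: "'a \<Rightarrow> real" and D assume \<psi>: "\<psi> \<in> C1c UNIV" "C1_gradient \<psi> D"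
    have b[measurable]: "\<psi> \<in> borel_measurable borel" "(\<lambda>x. D x \<bullet> v) \<in> borel_measurable borel"
      using C1c_continuous[OF \<psi>(1)] \<psi>(2)
      by (auto simp: C1_gradient_def intro!: borel_measurable_continuous_onI continuous_intros)
    have "(LINT x|lborel. U' x * (D x \<bullet> v)) = (LINT x|lebesgue. U' x * (D x \<bullet> v))"
      by (simp add: integral_completion)
    also have "\<dots> = (LINT x|lebesgue. U x * (D x \<bullet> v))"
    proof (rule integral_cong_AE)
      show "(\<lambda>x. U' x * (D x \<bullet> v)) \<in> borel_measurable lebesgue" by (intro cm) measurable
      show "(\<lambda>x. U x * (D x \<bullet> v)) \<in> borel_measurable lebesgue"
        by (rule borel_measurable_times[OF Um b(2)[THEN cm]])
      show "AE x in lebesgue. U' x * (D x \<bullet> v) = U x * (D x \<bullet> v)" using U'(2) by eventually_elim simp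
    qed
    also have "\<dots> = - (LINT x|lebesgue. g x * \<psi> x)" by (rule weak[OF \<psi>])
    also have "(LINT x|lebesgue. g x * \<psi> x) = (LINT x|lebesgue. g' x * \<psi> x)"
    proof (rule integral_cong_AE)
      show "(\<lambda>x. g' x * \<psi> x) \<in> borel_measurable lebesgue" by (intro cm) measurable
      show "(\<lambda>x. g x * \<psi> x) \<in> borel_measurable lebesgue"
        by (rule borel_measurable_times[OF gm b(1)[THEN cm]])
      show "AE x in lebesgue. g x * \<psi> x = g' x * \<psi> x" using g'(2) by eventually_elim simp
    qed
    also have "\<dots> = (LINT x|lborel. g' x * \<psi> x)" by (simp add: integral_completion)
    finally show "(LINT x|lborel. U' x * (D x \<bullet> v)) = - (LINT x|lborel. g' x * \<psi> x)" .
  qed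
  have "(LINT x|lebesgue. indicator A (U x) * g x) = (LINT x|lebesgue. indicator A (U' x) * g' x)"
  proof (rule integral_cong_AE)
    show "(\<lambda>x. indicator A (U x) * g x) \<in> borel_measurable lebesgue" using Um gm A by measurable
    note [measurable] = A
    show "(\<lambda>x. indicator A (U' x) * g' x) \<in> borel_measurable lebesgue" by (intro cm) measurable
    show "AE x in lebesgue. indicator A (U x) * g x = indicator A (U' x) * g' x"
      using U'(2) g'(2) by eventually_elim simp
  qed
  also have "\<dots> = (LINT x|lborel. indicator A (U' x) * g' x)" using A by (simp add: integral_completion)
  also have "\<dots> = 0" by (rule integral_weak_derivative_on_vimage[OF U'(1) g'(1) weak' A])
  finally show ?thesis .
qed

lemma integrable_L1_loc_bounded_subset:
  assumes "f \<in> L1_loc UNIV" "bounded \<Omega>" "\<Omega> \<in> sets lebesgue"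
  shows "integrable (lebesgue_on \<Omega>) f"
proof -
  have "integrable (lebesgue_on (closure \<Omega>)) f" using assms by (simp add: L1_loc_def)
  then have "integrable lebesgue (\<lambda>x. indicator (closure \<Omega>) x *\<^sub>R f x)" by (simp add: integrable_restrict_space)
  then have "integrable lebesgue (\<lambda>x. indicator \<Omega> x *\<^sub>R (indicator (closure \<Omega>) x *\<^sub>R f x))"
    by (rule integrable_mult_indicator[OF assms(3)])
  moreover have "(\<lambda>x. indicator \<Omega> x *\<^sub>R (indicator (closure \<Omega>) x *\<^sub>R f x)) = (\<lambda>x. indicator \<Omega> x *\<^sub>R f x)"
    using closure_subset[of \<Omega>] by (auto simp: fun_eq_iff indicator_def)
  ultimately show ?thesis using assms(3) by (simp add: integrable_restrict_space)
qed

text \<open>On \<Omega> the cutoff is 1 with zero gradient, so \<open>U\<close> and \<open>G\<close>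
  are the sum and the \<open>i\<close>-th component of its gradient. Off \<Omega> the indicator of
  \<open>A\<close> vanishes almost everywhere, whatever \<open>G\<close> is there.\<close>

lemma integral_gradient_on_vimage:
  fixes \<Omega> :: "'a::euclidean_space set"
  assumes \<Omega>: "open \<Omega>" "bounded \<Omega>" and p: "1 \<le> p"
    and \<phi>: "has_weak_gradient UNIV \<phi> f" and M: "AE x in lebesgue. \<bar>\<phi> x\<bar> \<le> M"
    and v: "v \<in> W1p_0 \<Omega> p" and g: "g \<in> Lp_space \<Omega> p" "has_weak_gradient \<Omega> v g"
    and A: "A \<in> sets borel" "A \<inter> {-M..M} = {}" and i: "i \<in> Basis"
  shows "(LINT x|lebesgue_on \<Omega>. indicator A (\<phi> x + v x) * ((f x + g x) \<bullet> i)) = 0"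
proof -
  have \<Omega>': "\<Omega> \<in> lmeasurable" "\<Omega> \<in> sets lebesgue" using \<Omega> by (auto simp: lmeasurable_open)
  obtain \<theta> where \<theta>: "\<theta> \<in> C1c UNIV" "\<And>x. x \<in> \<Omega> \<Longrightarrow> \<theta> x = 1" "\<And>x. 0 \<le> \<theta> x" "\<And>x. \<theta> x \<le> 1"
    using C1c_cutoff[OF \<Omega>(2)] by metis
  obtain D where D: "C1_gradient \<theta> D" using \<theta>(1) by (auto simp: C1c_iff)
  \<comment> \<open>Since \<Omega> is open, its points are outside the support of
    \<open>\<theta> - 1\<close>.\<close>
  have D0: "D x = 0" if "x \<in> \<Omega>" for x
  proof -
    have "C1_gradient (\<lambda>x. \<theta> x - 1) (\<lambda>x. D x - 0)" by (intro C1_gradient_diff D C1_gradient_const)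
    moreover have "closure {x. \<theta> x - 1 \<noteq> 0} \<subseteq> - \<Omega>"
      using \<Omega>(1) \<theta>(2) by (intro closure_minimal) auto
    ultimately show ?thesis using C1_gradient_zero_outside[of "\<lambda>x. \<theta> x - 1" "\<lambda>x. D x - 0" x] that by auto
  qed
  have L: "\<phi> \<in> L1_loc UNIV" "(\<lambda>x. f x \<bullet> i) \<in> L1_loc UNIV"
    using \<phi> L1_loc_inner by (auto simp: has_weak_gradient_def)
  have vi: "integrable (lebesgue_on \<Omega>) v" and gi: "integrable (lebesgue_on \<Omega>) (\<lambda>x. g x \<bullet> i)"
    using v g Lp_space_L1_bound(1)[OF \<Omega>'(1) p, of _ 1] by (auto simp: W1p_0_def W1p_def)
  note loc = integrable_L1_loc_mult_C1c[where \<Omega>=UNIV, unfolded lebesgue_on_UNIV_eq, simplified]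
  define U where "U x = \<phi> x * \<theta> x + indicator \<Omega> x * v x" for x
  define G where "G x = (f x \<bullet> i) * \<theta> x + \<phi> x * (D x \<bullet> i) + indicator \<Omega> x * (g x \<bullet> i)" for x
  have Ui: "integrable lebesgue U"
    using vi \<Omega>'(2) loc(1)[OF L(1) \<theta>(1) D] by (simp add: U_def[abs_def] integrable_restrict_space)
  have Gi: "integrable lebesgue G"
    using gi \<Omega>'(2) loc(1)[OF L(2) \<theta>(1) D] loc(2)[OF L(1) \<theta>(1) D]
    by (simp add: G_def[abs_def] integrable_restrict_space)
  have "(LINT x|lebesgue. indicator A (U x) * G x) = 0"
  proof (rule integral_weak_derivative_on_vimage_lebesgue[OF Ui Gi _ A(1)])
    fix \<Psi> :: "'a \<Rightarrow> real" and E assume \<Psi>: "\<Psi> \<in> C1c UNIV" "C1_gradient \<Psi> E"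
    obtain B where B: "\<And>x. \<bar>\<Psi> x\<bar> \<le> B" "\<And>x. norm (E x) \<le> B" using C1c_boundedE[OF \<Psi>] by metis
    have c: "continuous_on UNIV \<Psi>" "continuous_on UNIV (\<lambda>x. E x \<bullet> i)"
      using C1c_continuous[OF \<Psi>(1)] \<Psi>(2) by (auto simp: C1_gradient_def intro!: continuous_intros)
    have Ei: "\<bar>E x \<bullet> i\<bar> \<le> B" for x using B(2)[of x] Basis_le_norm[OF i, of "E x"] by linarith
    note mi = integrable_mult_bounded_continuous(1)[where S=UNIV, unfolded lebesgue_on_UNIV_eq, simplified]
    note i1 = mi[OF loc(1)[OF L(1) \<theta>(1) D] c(2) Ei]
    note i2 = mi[OF loc(2)[OF L(1) \<theta>(1) D] c(1) B(1)]
    note i3 = mi[OF loc(1)[OF L(2) \<theta>(1) D] c(1) B(1)]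
    have i4: "integrable lebesgue (\<lambda>x. indicator \<Omega> x * v x * (E x \<bullet> i))"
      using integrable_mult_bounded_continuous(1)[OF \<Omega>'(2) vi c(2) Ei] \<Omega>'(2)
      by (simp add: integrable_restrict_space mult.assoc)
    have i5: "integrable lebesgue (\<lambda>x. indicator \<Omega> x * (g x \<bullet> i) * \<Psi> x)"
      using integrable_mult_bounded_continuous(1)[OF \<Omega>'(2) gi c(1) B(1)] \<Omega>'(2)
      by (simp add: integrable_restrict_space mult.assoc)
    \<comment> \<open>Testing the weak gradient of \<open>\<phi>\<close> with
      \<open>\<theta> * \<Psi>\<close> yields the product rule for
      \<open>\<phi> * \<theta>\<close>.\<close>
    have "(LINT x|lebesgue. \<phi> x * ((\<theta> x *\<^sub>R E x + \<Psi> x *\<^sub>R D x) \<bullet> i)) = - (LINT x|lebesgue. (f x \<bullet> i) * (\<theta> x * \<Psi> x))"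
      using has_weak_gradientD[OF \<phi> C1c_mult[OF D \<Psi>(1)] C1_gradient_mult[OF D \<Psi>(2)] i]
      unfolding lebesgue_on_UNIV_eq .
    also have "(\<lambda>x. \<phi> x * ((\<theta> x *\<^sub>R E x + \<Psi> x *\<^sub>R D x) \<bullet> i)) = (\<lambda>x. \<phi> x * \<theta> x * (E x \<bullet> i) + \<phi> x * (D x \<bullet> i) * \<Psi> x)"
      by (simp add: inner_add_left algebra_simps)
    also have "(LINT x|lebesgue. \<phi> x * \<theta> x * (E x \<bullet> i) + \<phi> x * (D x \<bullet> i) * \<Psi> x) =
        (LINT x|lebesgue. \<phi> x * \<theta> x * (E x \<bullet> i)) + (LINT x|lebesgue. \<phi> x * (D x \<bullet> i) * \<Psi> x)"
      by (rule Bochner_Integration.integral_add[OF i1 i2])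
    finally have 1: "(LINT x|lebesgue. \<phi> x * \<theta> x * (E x \<bullet> i)) =
        - (LINT x|lebesgue. (f x \<bullet> i) * \<theta> x * \<Psi> x) - (LINT x|lebesgue. \<phi> x * (D x \<bullet> i) * \<Psi> x)"
      by (simp add: mult.assoc)
    have 2: "(LINT x|lebesgue. indicator \<Omega> x * v x * (E x \<bullet> i)) = - (LINT x|lebesgue. indicator \<Omega> x * (g x \<bullet> i) * \<Psi> x)"
      using W1p_0_by_parts[OF \<Omega> p v g \<Psi> i] \<Omega>'(2) by (simp add: integral_restrict_space mult.assoc)
    show "(LINT x|lebesgue. U x * (E x \<bullet> i)) = - (LINT x|lebesgue. G x * \<Psi> x)"
      using i1 i2 i3 i4 i5 1 2 by (simp add: U_def G_def distrib_right)
  qed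
  moreover have "(LINT x|lebesgue. indicator A (U x) * G x) =
      (LINT x|lebesgue. indicator \<Omega> x *\<^sub>R (indicator A (\<phi> x + v x) * ((f x + g x) \<bullet> i)))"
  proof -
    have eq: "AE x in lebesgue. indicator A (U x) * G x =
      indicator \<Omega> x *\<^sub>R (indicator A (\<phi> x + v x) * ((f x + g x) \<bullet> i))"
      using M
    proof eventually_elim
      fix x assume M: "\<bar>\<phi> x\<bar> \<le> M"
      show "indicator A (U x) * G x = indicator \<Omega> x *\<^sub>R (indicator A (\<phi> x + v x) * ((f x + g x) \<bullet> i))"
      proof (cases "x \<in> \<Omega>")
        case True
        then show ?thesis by (simp add: U_def G_def \<theta>(2) D0 inner_add_left)
      next
        case False
        have "\<bar>\<phi> x * \<theta> x\<bar> \<le> M" using M \<theta>(3,4)[of x] mult_left_le[of "\<theta> x" "\<bar>\<phi> x\<bar>"] by (simp add: abs_mult)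
        then have "U x \<in> {-M..M}" using False by (auto simp: U_def)
        then have "U x \<notin> A" using A(2) by blast
        then show ?thesis using False by simp
      qed
    qed
    have meas: "(\<lambda>x. indicator A (U x) * G x) \<in> borel_measurable lebesgue"
      using borel_measurable_integrable[OF Ui] borel_measurable_integrable[OF Gi] A(1) by measurable
    show ?thesis by (rule integral_cong_AE[OF meas borel_measurable_AE[OF meas eq] eq])
  qed
  ultimately show ?thesis using \<Omega>'(2) by (simp add: integral_restrict_space)
qed

subsection \<open>Piecewise constant slopes\<close>

lemma locally_bounded_compact:
  assumes "locally_bounded K" "compact S" shows "bounded (K ` S)"
proof -
  obtain N where N: "\<And>t. open (N t)" "\<And>t. t \<in> N t" "\<And>t. bounded (K ` N t)"
    using assms(1) unfolding locally_bounded_def by metis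
  obtain T where T: "finite T" "S \<subseteq> (\<Union>t\<in>T. N t)"
    by (rule compactE_image[OF assms(2), of UNIV N]) (use N in blast)+
  have "bounded (\<Union>t\<in>T. K ` N t)" using T(1) N(3) by (intro bounded_UN) auto
  then show ?thesis by (rule bounded_subset) (use T(2) in blast)
qed

text \<open>The subgradients may depend on \<open>t\<close> in a non-measurable way.  Allowing the error \<open>norm \<xi>\<close>
  makes it possible to choose them from a countable dense set, hence constant on each set of a
  countable Borel partition.\<close>

lemma subgradient_partition:
  fixes H :: "real \<times> 'a::euclidean_space \<Rightarrow> real"
  assumes H: "continuous_on UNIV H" and K: "K \<in> borel_measurable borel"
    and sub: "\<And>t. \<exists>\<zeta>. \<forall>\<xi>. H (t, \<xi>) \<ge> K t + \<zeta> \<bullet> \<xi>"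
  obtains E :: "nat \<Rightarrow> real set" and q :: "nat \<Rightarrow> 'a" where "disjoint_family E" "(\<Union>j. E j) = UNIV"
    "\<And>j. E j \<in> sets borel" "\<And>j t \<xi>. t \<in> E j \<Longrightarrow> K t + q j \<bullet> \<xi> \<le> H (t, \<xi>) + norm \<xi>"
proof -
  obtain Q :: "'a set" where Q: "countable Q" "\<And>X. open X \<Longrightarrow> X \<noteq> {} \<Longrightarrow> \<exists>d\<in>Q. d \<in> X"
    by (rule countable_dense_setE) blast
  then have "Q \<noteq> {}" using Q(2)[of UNIV] by auto
  define q where "q = from_nat_into Q"
  have q: "range q = Q" unfolding q_def using Q(1) \<open>Q \<noteq> {}\<close> by (rule range_from_nat_into[rotated])
  define S where "S j = {t. \<forall>\<xi>. K t + q j \<bullet> \<xi> \<le> H (t, \<xi>) + norm \<xi>}" for j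
  \<comment> \<open>Continuity of \<open>H\<close> in \<open>\<xi>\<close> lets the same dense
    sequence \<open>q\<close> serve as test vectors, so that \<open>S j\<close> is a countable
    intersection of Borel sets.\<close>
  have S_alt: "S j = (\<Inter>m. {t. K t + q j \<bullet> q m \<le> H (t, q m) + norm (q m)})" for j
  proof (intro equalityI subsetI)
    fix t assume t: "t \<in> (\<Inter>m. {t. K t + q j \<bullet> q m \<le> H (t, q m) + norm (q m)})"
    let ?X = "- {\<xi>. K t + q j \<bullet> \<xi> \<le> H (t, \<xi>) + norm \<xi>}"
    have "continuous_on UNIV (\<lambda>\<xi>. H (t, \<xi>))"
      by (intro continuous_on_compose2[OF H] continuous_intros) auto
    then have "open ?X" by (intro open_Compl closed_Collect_le continuous_intros)
    moreover have "\<xi> \<notin> ?X" if "\<xi> \<in> Q" for \<xi> using t that q by auto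
    ultimately have "?X = {}" using Q(2) by blast
    then show "t \<in> S j" by (auto simp: S_def)
  qed (auto simp: S_def)
  have S_borel: "S j \<in> sets borel" for j
  proof -
    have "continuous_on UNIV (\<lambda>t. H (t, c))" for c
      by (intro continuous_on_compose2[OF H] continuous_intros) auto
    then have [measurable]: "(\<lambda>t. H (t, c)) \<in> borel_measurable borel" for c
      by (rule borel_measurable_continuous_onI)
    note [measurable] = K
    show ?thesis unfolding S_alt by measurable
  qed
  have S_UN: "(\<Union>j. S j) = UNIV"
  proof (intro equalityI subsetI UNIV_I)
    fix t
    obtain \<zeta> where \<zeta>: "\<And>\<xi>. H (t, \<xi>) \<ge> K t + \<zeta> \<bullet> \<xi>" using sub by blast
    \<comment> \<open>Radius 1 matches the error: a slope within distance 1 of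
      \<open>\<zeta>\<close> changes the inner product by at most \<open>norm \<xi>\<close>.\<close>
    obtain d where "d \<in> Q" "d \<in> ball \<zeta> 1" using Q(2)[of "ball \<zeta> 1"] by auto
    then obtain j where "dist \<zeta> (q j) < 1" using q by auto
    then have j: "norm (q j - \<zeta>) \<le> 1" by (simp add: dist_norm norm_minus_commute)
    have "K t + q j \<bullet> \<xi> \<le> H (t, \<xi>) + norm \<xi>" for \<xi>
    proof -
      have "(q j - \<zeta>) \<bullet> \<xi> \<le> norm (q j - \<zeta>) * norm \<xi>" by (rule norm_cauchy_schwarz)
      also have "\<dots> \<le> 1 * norm \<xi>" using j by (intro mult_right_mono) auto
      finally show ?thesis using \<zeta>[of \<xi>] by (simp add: inner_diff_left)
    qed
    then show "t \<in> (\<Union>j. S j)" by (auto simp: S_def)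
  qed
  show ?thesis
  proof (rule that[of "disjointed S" q])
    show "disjointed S j \<in> sets borel" for j
      using sets.range_disjointed_sets[of S borel] S_borel by auto
    show "K t + q j \<bullet> \<xi> \<le> H (t, \<xi>) + norm \<xi>" if "t \<in> disjointed S j" for j t \<xi>
      using that disjointed_subset[of S j] by (auto simp: S_def)
  qed (auto simp: disjoint_family_disjointed UN_disjointed_eq S_UN)
qed

section \<open>Integrability of \<open>K \<circ> u\<close>: summation over the pieces and the
  bounded range\<close>

theorem lemma3p1:
  fixes \<Omega> :: "(real ^ 'n) set" and p :: real and \<phi> :: "real ^ 'n \<Rightarrow> real"
    and H :: "real \<times> (real ^ 'n) \<Rightarrow> real" and K :: "real \<Rightarrow> real"
  assumes "open \<Omega>" and "bounded \<Omega>"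
    and "1 \<le> p" and "p \<le> real CARD('n)"
    and "\<phi> \<in> W1p UNIV p" and "\<phi> \<in> Linf_space UNIV"
    and "continuous_on UNIV H" and "\<And>t \<xi>. 0 \<le> H (t, \<xi>)"
    and "K \<in> borel_measurable borel" and "locally_bounded K" and "\<And>t. 0 \<le> K t"
    and "\<And>t. \<exists>\<zeta>. \<forall>\<xi>. H (t, \<xi>) \<ge> K t + \<zeta> \<bullet> \<xi>"
  shows "\<forall>u \<in> admissible \<Omega> p \<phi> H. integrable (lebesgue_on \<Omega>) (K \<circ> u)"
proof
  fix u assume u: "u \<in> admissible \<Omega> p \<phi> H"
  note \<Omega> = assms(1,2) and p = assms(3) and K0 = assms(11)
  have \<Omega>': "\<Omega> \<in> lmeasurable" "\<Omega> \<in> sets lebesgue" using \<Omega> by (auto simp: lmeasurable_open)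
  interpret finite_measure "lebesgue_on \<Omega>" using \<Omega>'(1) by (rule finite_measure_lebesgue_on)
  obtain f where f: "has_weak_gradient UNIV \<phi> f" using assms(5) by (auto simp: W1p_def)
  obtain v where v: "v \<in> W1p_0 \<Omega> p" and u_eq: "u = (\<lambda>x. \<phi> x + v x)"
    using u by (auto simp: admissible_def W1p_bdry_def)
  obtain g where g: "g \<in> Lp_space \<Omega> p" "has_weak_gradient \<Omega> v g"
    using v by (auto simp: W1p_0_def W1p_def)
  obtain M where M: "AE x in lebesgue. \<bar>\<phi> x\<bar> \<le> M"
    using assms(6) unfolding Linf_space_def lebesgue_on_UNIV_eq by auto
  define G where "G x = f x + g x" for x
  let ?W = "weak_gradient \<Omega> u"
  have grad: "AE x in lebesgue_on \<Omega>. ?W x = G x"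
    unfolding u_eq G_def by (rule weak_gradient_AE_eq[OF \<Omega>(1) has_weak_gradient_add[OF \<Omega>(1) has_weak_gradient_subset[OF f \<Omega>(1)] g(2)]])
  have loc: "\<phi> \<in> L1_loc UNIV" "f \<in> L1_loc UNIV" using f by (auto simp: has_weak_gradient_def)
  have Gi: "integrable (lebesgue_on \<Omega>) G"
    using integrable_L1_loc_bounded_subset[OF loc(2) \<Omega>(2) \<Omega>'(2)] Lp_space_L1_bound(1)[OF \<Omega>'(1) p g(1), of 1]
    by (simp add: G_def[abs_def])
  have [measurable]: "u \<in> borel_measurable (lebesgue_on \<Omega>)"
    using integrable_L1_loc_bounded_subset[OF loc(1) \<Omega>(2) \<Omega>'(2)] v
    by (auto simp: u_eq W1p_0_def W1p_def Lp_space_def)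
  note [measurable] = assms(9)
  have [measurable]: "G \<in> borel_measurable (lebesgue_on \<Omega>)" using Gi by auto
  have Hi: "integrable (lebesgue_on \<Omega>) (\<lambda>x. H (u x, ?W x))" using u by (simp add: admissible_def)
  define h where "h x = H (u x, ?W x) + norm (G x)" for x
  have h: "integrable (lebesgue_on \<Omega>) h" "\<And>x. 0 \<le> h x" using Hi Gi assms(8) by (auto simp: h_def[abs_def])
  have [measurable]: "h \<in> borel_measurable (lebesgue_on \<Omega>)" using h by auto
  obtain E :: "nat \<Rightarrow> real set" and q :: "nat \<Rightarrow> real ^ 'n"
    where E: "disjoint_family E" "(\<Union>j. E j) = UNIV" "\<And>j. E j \<in> sets borel"
      and Eq: "\<And>j t \<xi>. t \<in> E j \<Longrightarrow> K t + q j \<bullet> \<xi> \<le> H (t, \<xi>) + norm \<xi>"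
    by (rule subgradient_partition[OF assms(7,9,12)]) blast
  define F where "F j = E j - {-M..M}" for j
  have F: "disjoint_family F" "(\<Union>j. F j) = - {-M..M}" and [measurable]: "\<And>j. F j \<in> sets borel"
    using E by (auto simp: F_def disjoint_family_on_def)
  \<comment> \<open>Because \<open>F j\<close> avoids \<open>{-M..M}\<close>, the term with the
    constant slope \<open>q j\<close> integrates to 0. Nonnegative integrals make the later sum over
    \<open>j\<close> meaningful without a bound on the slopes.\<close>
  have KF: "(\<integral>\<^sup>+x. ennreal (K (u x)) * indicator (F j) (u x) \<partial>lebesgue_on \<Omega>) \<le>
      (\<integral>\<^sup>+x. ennreal (h x) * indicator (F j) (u x) \<partial>lebesgue_on \<Omega>)" for j
  proof -
    let ?I = "\<lambda>x. indicator (F j) (u x) :: real"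
    have hI: "integrable (lebesgue_on \<Omega>) (\<lambda>x. ?I x * h x)"
      by (rule Bochner_Integration.integrable_bound[OF h(1)]) (auto simp: indicator_def)
    have comp: "integrable (lebesgue_on \<Omega>) (\<lambda>x. ?I x * (G x \<bullet> i))" for i
      by (rule Bochner_Integration.integrable_bound[OF integrable_inner_left[OF Gi]]) (auto simp: indicator_def)
    \<comment> \<open>The vanishing integral is available for each coordinate of \<open>G\<close>
      separately.\<close>
    have qG: "?I x * (q j \<bullet> G x) = (\<Sum>i\<in>Basis. (q j \<bullet> i) * (?I x * (G x \<bullet> i)))" for x
      by (subst euclidean_inner) (simp add: sum_distrib_left mult_ac)
    have qGi: "integrable (lebesgue_on \<Omega>) (\<lambda>x. ?I x * (q j \<bullet> G x))"
      unfolding qG using comp by (intro Bochner_Integration.integrable_sum integrable_mult_right)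
    have "(LINT x|lebesgue_on \<Omega>. ?I x * (G x \<bullet> i)) = 0" if "i \<in> Basis" for i
      unfolding u_eq G_def
      by (rule integral_gradient_on_vimage[OF \<Omega> p f M v g _ _ that]) (auto simp: F_def E(3))
    then have q0: "(LINT x|lebesgue_on \<Omega>. ?I x * (q j \<bullet> G x)) = 0"
      unfolding qG using comp by (subst Bochner_Integration.integral_sum) auto
    have le: "AE x in lebesgue_on \<Omega>. ?I x * K (u x) \<le> ?I x * h x - ?I x * (q j \<bullet> G x)"
      using grad
    proof eventually_elim
      fix x assume W: "?W x = G x"
      show "?I x * K (u x) \<le> ?I x * h x - ?I x * (q j \<bullet> G x)"
      proof (cases "u x \<in> F j")
        case True
        then have "u x \<in> E j" by (simp add: F_def)
        from Eq[OF this, of "G x"] True W show ?thesis by (simp add: h_def)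
      qed simp
    qed
    \<comment> \<open>As \<open>K\<close> is nonnegative, the pointwise inequality \<open>le\<close>
      is itself an integrable bound, so integrability on one piece comes before any control of the
      total.\<close>
    have KI: "integrable (lebesgue_on \<Omega>) (\<lambda>x. ?I x * K (u x))"
    proof (rule Bochner_Integration.integrable_bound)
      show "integrable (lebesgue_on \<Omega>) (\<lambda>x. ?I x * h x - ?I x * (q j \<bullet> G x))" using hI qGi by simp
      show "AE x in lebesgue_on \<Omega>. norm (?I x * K (u x)) \<le> norm (?I x * h x - ?I x * (q j \<bullet> G x))"
        using le by eventually_elim (use K0 in \<open>auto intro: order_trans[OF _ abs_ge_self]\<close>)
    qed measurable
    have "(LINT x|lebesgue_on \<Omega>. ?I x * K (u x)) \<le> (LINT x|lebesgue_on \<Omega>. ?I x * h x - ?I x * (q j \<bullet> G x))"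
      using KI hI qGi le by (intro integral_mono_AE) auto
    also have "\<dots> = (LINT x|lebesgue_on \<Omega>. ?I x * h x)" using hI qGi q0 by simp
    finally have "(\<integral>\<^sup>+x. ennreal (?I x * K (u x)) \<partial>lebesgue_on \<Omega>) \<le> (\<integral>\<^sup>+x. ennreal (?I x * h x) \<partial>lebesgue_on \<Omega>)"
      using KI hI K0 h(2) by (simp add: nn_integral_eq_integral)
    moreover have "ennreal (?I x * c) = ennreal c * indicator (F j) (u x)" for x c
      by (simp add: indicator_def)
    ultimately show ?thesis by simp
  qed
  have split: "(\<Sum>j. ennreal c * indicator (F j) t) = ennreal c * indicator (- {-M..M}) t" for c t
    using F by (simp add: ennreal_suminf_cmult suminf_indicator)
  have "(\<integral>\<^sup>+x. ennreal (K (u x)) * indicator (- {-M..M}) (u x) \<partial>lebesgue_on \<Omega>) =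
      (\<Sum>j. \<integral>\<^sup>+x. ennreal (K (u x)) * indicator (F j) (u x) \<partial>lebesgue_on \<Omega>)"
    unfolding split[symmetric] by (rule nn_integral_suminf) measurable
  also have "\<dots> \<le> (\<Sum>j. \<integral>\<^sup>+x. ennreal (h x) * indicator (F j) (u x) \<partial>lebesgue_on \<Omega>)"
    by (intro suminf_le KF summableI)
  also have "\<dots> = (\<integral>\<^sup>+x. ennreal (h x) * indicator (- {-M..M}) (u x) \<partial>lebesgue_on \<Omega>)"
    unfolding split[symmetric] by (rule nn_integral_suminf[symmetric]) measurable
  also have "\<dots> \<le> (\<integral>\<^sup>+x. ennreal (h x) \<partial>lebesgue_on \<Omega>)"
    by (intro nn_integral_mono) (auto simp: indicator_def)
  also have "\<dots> < \<infinity>" using h by (simp add: nn_integral_eq_integral)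
  finally have far: "(\<integral>\<^sup>+x. ennreal (K (u x)) * indicator (- {-M..M}) (u x) \<partial>lebesgue_on \<Omega>) < \<infinity>" .
  \<comment> \<open>On the remaining range of values no gradient estimate is needed:
    \<open>K\<close> is bounded there and \<Omega> has finite measure.\<close>
  have "bounded (K ` {-M..M})" by (rule locally_bounded_compact[OF assms(10)]) simp
  then obtain B where B: "\<And>t. t \<in> {-M..M} \<Longrightarrow> \<bar>K t\<bar> \<le> B" unfolding bounded_iff by force
  have "(\<integral>\<^sup>+x. ennreal (K (u x)) \<partial>lebesgue_on \<Omega>) \<le>
      (\<integral>\<^sup>+x. ennreal B + ennreal (K (u x)) * indicator (- {-M..M}) (u x) \<partial>lebesgue_on \<Omega>)"
    using B by (intro nn_integral_mono) (force simp: indicator_def intro: ennreal_leI)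
  also have "\<dots> = (\<integral>\<^sup>+x. ennreal B \<partial>lebesgue_on \<Omega>) +
      (\<integral>\<^sup>+x. ennreal (K (u x)) * indicator (- {-M..M}) (u x) \<partial>lebesgue_on \<Omega>)"
    by (rule nn_integral_add) measurable
  also have "\<dots> < \<infinity>" using far by (simp add: ennreal_mult_eq_top_iff less_top[symmetric])
  finally show "integrable (lebesgue_on \<Omega>) (K \<circ> u)"
    using K0 by (intro integrableI_bounded) (auto simp: o_def)
qed

end
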